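(* Let $T>0$ and $d\in\{1,2,3\}$. Let $a:[0,\infty)\to[0,\infty)$ be a continuous function with $a(0)=0$ and $a(\eta)>0$ for $\eta>0$, and let $\widetilde K:([0,\infty)\times\mathbb{R}^d)^2\to\mathbb{C}$ be a bounded function. Let $\lambda\in\mathbb{C}$ be an arbitrary constant. Consider the following integral equation for the unknown $\psi(\eta_1,\mathbf{x}_1,\eta_2,\mathbf{x}_2)$, $\eta_1,\eta_2\in[0,T]$, $\mathbf{x}_1,\mathbf{x}_2\in\mathbb{R}^d$, depending on $d$: For $d=1$ (writing $z_i$ for $\mathbf{x}_i$): $$\psi(\eta_1,z_1,\eta_2,z_2)=\psi^{\rm free}(\eta_1,z_1,\eta_2,z_2)+\frac{\lambda}{4}\int_0^{\eta_1}\!d\eta_1'\int_0^{\eta_2}\!d\eta_2'\int_{\mathbb{R}}\!dz_1'\int_{\mathbb{R}}\!dz_2'\;a^2(\eta_1')a^2(\eta_2')\,H(\eta_1-\eta_1'-|z_1-z_1'|)\,H(\eta_2-\eta_2'-|z_2-z_2'|)\,\widetilde K(\eta_1',z_1',\eta_2',z_2')\,\psi(\eta_1',z_1',\eta_2',z_2').$$ For $d=2$: $$\psi(\eta_1,\mathbf{x}_1,\eta_2,\mathbf{x}_2)=\psi^{\rm free}(\eta_1,\mathbf{x}_1,\eta_2,\mathbf{x}_2)+\frac{\lambda}{(2\pi)^2}\frac{1}{[a(\eta_1)a(\eta_2)]^{1/2}}\int_0^{\eta_1}\!d\eta_1'\int_0^{\eta_2}\!d\eta_2'\int_{\mathbb{R}^2}\!d^2\mathbf{x}_1'\int_{\mathbb{R}^2}\!d^2\mathbf{x}_2'\;a^2(\eta_1')a^2(\eta_2')\,\frac{H(\eta_1-\eta_1'-|\mathbf{x}_1-\mathbf{x}_1'|)}{\sqrt{(\eta_1-\eta_1')^2-|\mathbf{x}_1-\mathbf{x}_1'|^2}}\,\frac{H(\eta_2-\eta_2'-|\mathbf{x}_2-\mathbf{x}_2'|)}{\sqrt{(\eta_2-\eta_2')^2-|\mathbf{x}_2-\mathbf{x}_2'|^2}}\,\widetilde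 K(\eta_1',\mathbf{x}_1',\eta_2',\mathbf{x}_2')\,\psi(\eta_1',\mathbf{x}_1',\eta_2',\mathbf{x}_2').$$ For $d=3$: $$\psi(\eta_1,\mathbf{x}_1,\eta_2,\mathbf{x}_2)=\psi^{\rm free}(\eta_1,\mathbf{x}_1,\eta_2,\mathbf{x}_2)+\frac{\lambda}{(4\pi)^2}\frac{1}{a(\eta_1)a(\eta_2)}\int_{\mathbb{R}^3}\!d^3\mathbf{x}_1'\int_{\mathbb{R}^3}\!d^3\mathbf{x}_2'\;a^2(\eta_1-|\mathbf{x}_1-\mathbf{x}_1'|)\,a^2(\eta_2-|\mathbf{x}_2-\mathbf{x}_2'|)\,\frac{H(\eta_1-|\mathbf{x}_1-\mathbf{x}_1'|)}{|\mathbf{x}_1-\mathbf{x}_1'|}\,\frac{H(\eta_2-|\mathbf{x}_2-\mathbf{x}_2'|)}{|\mathbf{x}_2-\mathbf{x}_2'|}\,\widetilde K(\eta_1-|\mathbf{x}_1-\mathbf{x}_1'|,\mathbf{x}_1',\eta_2-|\mathbf{x}_2-\mathbf{x}_2'|,\mathbf{x}_2')\,\psi(\eta_1-|\mathbf{x}_1-\mathbf{x}_1'|,\mathbf{x}_1',\eta_2-|\mathbf{x}_2-\mathbf{x}_2'|,\mathbf{x}_2'),$$ where the integrand is understood to be zero whenever one of the Heaviside factors vanishes. Then for every $\psi^{\rm free}$ with $a^{\frac{d-1}{2}}(\eta_1)\,a^{\frac{d-1}{2}}(\eta_2)\,\psi^{\rm free}\in\mathscr{B}_d$, the integral equation for the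 respective $d$ has a unique solution $\psi$ with $a^{\frac{d-1}{2}}(\eta_1)\,a^{\frac{d-1}{2}}(\eta_2)\,\psi\in\mathscr{B}_d$, for $0\le\eta_1,\eta_2\le T$.
   Context: $H$ denotes the Heaviside function. For $T>0$ and $d\in\{1,2,3\}$, $\mathscr{B}_d:=L^\infty\big([0,T]^2_{(\eta_1,\eta_2)},L^2(\mathbb{R}^{2d}_{(\mathbf{x}_1,\mathbf{x}_2)})\big)$ is the Banach space with norm $\|\psi\|_{\mathscr{B}_d}=\operatorname{ess\,sup}_{\eta_1,\eta_2\in[0,T]}\|\psi(\eta_1,\cdot,\eta_2,\cdot)\|_{L^2(\mathbb{R}^{2d})}$. (These equations arise as simplified multi-time integral equations for two massless scalar particles with retarded interaction on a flat FLRW spacetime with conformal time $\eta$ and scale function $a$.)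
   Formalization: The bounded function K̃ is additionally assumed to be (Borel) measurable, since for a non-measurable K̃ the integrals are undefined; the equation and the uniqueness are understood almost everywhere, as for elements of the space B_d. *)

theory Defs
  imports "HOL-Analysis.Analysis"
begin

type_synonym 'n field2 = "real \<Rightarrow> real^'n \<Rightarrow> real \<Rightarrow> real^'n \<Rightarrow> complex"

text \<open>Heaviside function (value at 0 is irrelevant: null sets).\<close>
definition Heav :: "real \<Rightarrow> real" where
  "Heav s = (if s \<ge> 0 then 1 else 0)"

text \<open>Membership in the Banach space B_d = L-infinity([0,T]^2, L2(R^(2d))):
  the function, restricted to the time domain [0,T]^2, is (jointly) Borel measurable,
  and for almost every (eta1, eta2) in [0,T]^2 the spatial slice is square integrable
  with L2 norm bounded by a common constant C (finite essential supremum).\<close>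
definition inB :: "real \<Rightarrow> 'n::finite field2 \<Rightarrow> bool" where
  "inB T \<psi> \<longleftrightarrow>
     (\<lambda>(\<eta>1, x1, \<eta>2, x2). if \<eta>1 \<in> {0..T} \<and> \<eta>2 \<in> {0..T} then \<psi> \<eta>1 x1 \<eta>2 x2 else 0)
        \<in> borel_measurable lborel \<and>
     (\<exists>C::real. AE \<eta>\<eta> in (lborel :: (real \<times> real) measure).
        fst \<eta>\<eta> \<in> {0..T} \<and> snd \<eta>\<eta> \<in> {0..T} \<longrightarrow>
          integrable lborel (\<lambda>(x1, x2). (cmod (\<psi> (fst \<eta>\<eta>) x1 (snd \<eta>\<eta>) x2))\<^sup>2) \<and>
          (\<integral>(x1, x2). (cmod (\<psi> (fst \<eta>\<eta>) x1 (snd \<eta>\<eta>) x2))\<^sup>2 \<partial>lborel) \<le> C)"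

text \<open>Weight a(eta)^((d-1)/2), written as sqrt(a(eta)^(d-1)) so that it equals 1 for d = 1.\<close>
definition wgt :: "nat \<Rightarrow> (real \<Rightarrow> real) \<Rightarrow> real \<Rightarrow> real" where
  "wgt d a \<eta> = sqrt (a \<eta> ^ (d - 1))"

definition weighted :: "nat \<Rightarrow> (real \<Rightarrow> real) \<Rightarrow> 'n field2 \<Rightarrow> 'n field2" where
  "weighted d a \<psi> = (\<lambda>\<eta>1 x1 \<eta>2 x2.
      complex_of_real (wgt d a \<eta>1 * wgt d a \<eta>2) * \<psi> \<eta>1 x1 \<eta>2 x2)"

definition intop1 :: "(real \<Rightarrow> real) \<Rightarrow> 'n::finite field2 \<Rightarrow> complex \<Rightarrow> 'n field2 \<Rightarrow> 'n field2" where
  "intop1 a K c \<psi> = (\<lambda>\<eta>1 x1 \<eta>2 x2.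
     c / 4 * (\<integral>(\<eta>1', x1', \<eta>2', x2'). 
        (if \<eta>1' \<in> {0..\<eta>1} \<and> \<eta>2' \<in> {0..\<eta>2} then
          complex_of_real ((a \<eta>1')\<^sup>2 * (a \<eta>2')\<^sup>2
             * Heav (\<eta>1 - \<eta>1' - norm (x1 - x1')) * Heav (\<eta>2 - \<eta>2' - norm (x2 - x2')))
          * K \<eta>1' x1' \<eta>2' x2' * \<psi> \<eta>1' x1' \<eta>2' x2'
         else 0) \<partial>lborel))"

definition intop2 :: "(real \<Rightarrow> real) \<Rightarrow> 'n::finite field2 \<Rightarrow> complex \<Rightarrow> 'n field2 \<Rightarrow> 'n field2" where
  "intop2 a K c \<psi> = (\<lambda>\<eta>1 x1 \<eta>2 x2.
     c / (2 * pi)\<^sup>2 * complex_of_real (1 / sqrt (a \<eta>1 * a \<eta>2))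
     * (\<integral>(\<eta>1', x1', \<eta>2', x2'). 
        (if \<eta>1' \<in> {0..\<eta>1} \<and> \<eta>2' \<in> {0..\<eta>2} then
          complex_of_real ((a \<eta>1')\<^sup>2 * (a \<eta>2')\<^sup>2
             * (Heav (\<eta>1 - \<eta>1' - norm (x1 - x1')) / sqrt ((\<eta>1 - \<eta>1')\<^sup>2 - (norm (x1 - x1'))\<^sup>2))
             * (Heav (\<eta>2 - \<eta>2' - norm (x2 - x2')) / sqrt ((\<eta>2 - \<eta>2')\<^sup>2 - (norm (x2 - x2'))\<^sup>2)))
          * K \<eta>1' x1' \<eta>2' x2' * \<psi> \<eta>1' x1' \<eta>2' x2'
         else 0) \<partial>lborel))"

definition intop3 :: "(real \<Rightarrow> real) \<Rightarrow> 'n::finite field2 \<Rightarrow> complex \<Rightarrow> 'n field2 \<Rightarrow> 'n field2" where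
  "intop3 a K c \<psi> = (\<lambda>\<eta>1 x1 \<eta>2 x2.
     c / (4 * pi)\<^sup>2 * complex_of_real (1 / (a \<eta>1 * a \<eta>2))
     * (\<integral>(x1', x2'). 
        (if Heav (\<eta>1 - norm (x1 - x1')) = 0 \<or> Heav (\<eta>2 - norm (x2 - x2')) = 0 then 0 else
          complex_of_real ((a (\<eta>1 - norm (x1 - x1')))\<^sup>2 * (a (\<eta>2 - norm (x2 - x2')))\<^sup>2
             * (Heav (\<eta>1 - norm (x1 - x1')) / norm (x1 - x1'))
             * (Heav (\<eta>2 - norm (x2 - x2')) / norm (x2 - x2')))
          * K (\<eta>1 - norm (x1 - x1')) x1' (\<eta>2 - norm (x2 - x2')) x2'
          * \<psi> (\<eta>1 - norm (x1 - x1')) x1' (\<eta>2 - norm (x2 - x2')) x2') \<partial>lborel))"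

definition intop :: "(real \<Rightarrow> real) \<Rightarrow> 'n::finite field2 \<Rightarrow> complex \<Rightarrow> 'n field2 \<Rightarrow> 'n field2" where
  "intop a K c \<psi> =
     (if CARD('n) = 1 then intop1 a K c \<psi>
      else if CARD('n) = 2 then intop2 a K c \<psi>
      else intop3 a K c \<psi>)"

definition solves :: "real \<Rightarrow> (real \<Rightarrow> real) \<Rightarrow> 'n::finite field2 \<Rightarrow> complex \<Rightarrow> 'n field2 \<Rightarrow> 'n field2 \<Rightarrow> bool" where
  "solves T a K c \<psi>free \<psi> \<longleftrightarrow>
     (AE p in lborel. case p of (\<eta>1, x1, \<eta>2, x2) \<Rightarrow>
        \<eta>1 \<in> {0..T} \<and> \<eta>2 \<in> {0..T} \<longrightarrow>
          \<psi> \<eta>1 x1 \<eta>2 x2 = \<psi>free \<eta>1 x1 \<eta>2 x2 + intop a K c \<psi> \<eta>1 x1 \<eta>2 x2)"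

end

theory Submission
  imports Defs
begin

text \<open>
  After multiplication by the weights, each of the three equations becomes a convolution equation
  \<open>\<xi> = f + \<integral> k (p - u) \<xi> (p - u) d\<nu>(u)\<close> with a bounded kernel \<open>k\<close> and a finite measure \<open>\<nu>\<close> of
  space-time displacements whose time components are nonnegative and almost surely have positive
  sum. By Cauchy--Schwarz the integral operator maps functions whose slices satisfy
  \<open>\<parallel>\<xi>(\<eta>1, \<eta>2)\<parallel>\<^sup>2 \<le> C exp (2 \<kappa> (\<eta>1 + \<eta>2))\<close> to functions of the same kind with \<open>C\<close> multiplied by the
  square of \<open>sup \<bar>k\<bar> \<cdot> \<integral> exp (- \<kappa> (s1 + s2)) d\<nu>\<close>, which tends to 0 as \<open>\<kappa> \<rightarrow> \<infinity>\<close>. Hence for large \<open>\<kappa>\<close> the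
  operator is a contraction: differences of solutions vanish, and the Neumann series converges
  absolutely almost everywhere, dominated by the corresponding series of nonnegative functions.
\<close>

section \<open>Lebesgue measure on products\<close>

text \<open>For d = 1, 2 the Green functions are densities, but for d = 3 the integral runs over a
  product of two light cones, a Lebesgue null set, while the equation is only meant almost
  everywhere. Convolution with a possibly singular measure \<open>\<nu>\<close> covers all cases:
  for each fixed displacement a translation preserves null sets, and Fubini turns this into a
  statement about almost every base point. No Banach space of classes is formed. Estimates concern
  squared slice norms in \<open>ennreal\<close>, where integrals exist without integrability proofs;
  monotone convergence of a dominating series replaces completeness. The price is
  \<open>(x + y)\<^sup>2 \<le> 2 * x\<^sup>2 + 2 * y\<^sup>2\<close> in place of Minkowski's
  inequality, which explains the constants 1/4 and \<open>4 * C\<close>. The exponential weight is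
  needed because the coupling constant and \<open>T\<close> are arbitrary, so the operator need not
  contract the plain essential supremum norm. The powers of \<open>a\<close> are needed because the
  prefactors of the original equation are singular at the initial time for d = 2, 3.\<close>

lemma lborel_distr_reflect:
  fixes p :: "'a::euclidean_space"
  shows "distr lborel borel (\<lambda>u. p - u) = lborel"
  using lborel_affine[of "-1" p] by (simp add: density_1)

lemma lborel_distr_translate:
  fixes c :: "'a::euclidean_space"
  shows "distr lborel borel (\<lambda>u. u - c) = lborel"
  using lborel_distr_plus[of "- c"] by (simp add: add.commute[of "- c"] cong: distr_cong)

lemma AE_lborel_translate:
  fixes c :: "'a::euclidean_space"
  assumes "AE t in lborel. Q t"
  shows "AE t in lborel. Q (t - c)"
proof -
  have "AE t in distr lborel borel (\<lambda>u. u - c). Q t"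
    using assms unfolding lborel_distr_translate .
  then show ?thesis
    by (rule AE_distrD[rotated]) measurable
qed

lemma nn_integral_lborel_translate:
  fixes c :: "'a::euclidean_space"
  assumes [measurable]: "f \<in> borel_measurable borel"
  shows "(\<integral>\<^sup>+x. f (x - c) \<partial>lborel) = (\<integral>\<^sup>+x. f x \<partial>lborel)"
  by (subst (2) lborel_distr_translate[of c, symmetric]) (simp add: nn_integral_distr)

lemma integral_lborel_reflect:
  fixes p :: "'a::euclidean_space" and f :: "'a \<Rightarrow> 'b::{banach, second_countable_topology}"
  assumes [measurable]: "f \<in> borel_measurable borel"
  shows "(\<integral>x. f x \<partial>lborel) = (\<integral>u. f (p - u) \<partial>lborel)"
  by (subst lborel_distr_reflect[of p, symmetric]) (simp add: integral_distr)

text \<open>All functions below live on nested product types with their \<open>borel\<close>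
  sigma-algebra rather than on \<open>borel \<Otimes>\<^sub>M borel\<close>; this rule and the next
  let \<open>measurable\<close> take such tuples apart.\<close>

lemma borel_measurable_fst' [measurable (raw)]:
  fixes f :: "'a \<Rightarrow> 'b::second_countable_topology \<times> 'c::second_countable_topology"
  assumes "f \<in> borel_measurable M" shows "(\<lambda>x. fst (f x)) \<in> borel_measurable M"
  using assms by (auto simp: borel_prod[symmetric])

lemma borel_measurable_snd' [measurable (raw)]:
  fixes f :: "'a \<Rightarrow> 'b::second_countable_topology \<times> 'c::second_countable_topology"
  assumes "f \<in> borel_measurable M" shows "(\<lambda>x. snd (f x)) \<in> borel_measurable M"
  using assms by (auto simp: borel_prod[symmetric])

lemma AE_lborel_pairD:
  fixes Q :: "'a::euclidean_space \<times> 'b::euclidean_space \<Rightarrow> bool"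
  assumes "AE p in lborel. Q p"
  shows "AE t in lborel. AE x in lborel. Q (t, x)"
  using assms by (subst (asm) lborel_prod[symmetric]) (rule lborel_pair.AE_pair)

text \<open>Unlike the converse, this needs measurability of \<open>Q\<close>: a non-measurable set
  with null slices need not be a null set.\<close>

lemma AE_lborel_pairI:
  fixes Q :: "'a::euclidean_space \<times> 'b::euclidean_space \<Rightarrow> bool"
  assumes "AE t in lborel. AE x in lborel. Q (t, x)" and "Measurable.pred borel Q"
  shows "AE p in lborel. Q p"
  unfolding lborel_prod[symmetric]
proof (rule lborel_pair.AE_pair_measure[OF _ assms(1)])
  show "{x \<in> space (lborel \<Otimes>\<^sub>M lborel). Q x} \<in> sets (lborel \<Otimes>\<^sub>M lborel)"
    using assms(2) by (simp only: lborel_prod pred_def sets_lborel space_lborel space_borel)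
qed

text \<open>Serves as a triangle inequality for squared slice norms, so that no square roots have to
  be taken in \<open>ennreal\<close>.\<close>

lemma ennreal_sum_squared_le: "(x + y)\<^sup>2 \<le> 2 * x\<^sup>2 + 2 * y\<^sup>2" for x y :: ennreal
proof (cases x; cases y)
  fix a b :: real assume *: "x = ennreal a" "0 \<le> a" "y = ennreal b" "0 \<le> b"
  have "(a + b)\<^sup>2 \<le> 2 * a\<^sup>2 + 2 * b\<^sup>2"
    using sum_squares_bound[of a b] by (simp add: power2_sum)
  then have "ennreal ((a + b)\<^sup>2) \<le> ennreal (2 * a\<^sup>2 + 2 * b\<^sup>2)"
    by (rule ennreal_leI)
  then show ?thesis
    using * by (simp add: ennreal_mult ennreal_plus ennreal_power[symmetric])
qed (auto simp: power2_eq_square ennreal_top_mult ennreal_mult_top)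

section \<open>Retarded convolution equations\<close>

text \<open>The norm condition of \<open>inB\<close> with a nonnegative integral: finiteness of the
  integral contains square integrability of the slice, so one inequality suffices once measurability
  is known.\<close>

definition bounded_slices ::
    "'t::euclidean_space set \<Rightarrow> ('t \<times> 'x::euclidean_space \<Rightarrow> complex) \<Rightarrow> bool" where
  "bounded_slices D f \<longleftrightarrow> (\<exists>C::real. AE t in lborel. t \<in> D \<longrightarrow>
     (\<integral>\<^sup>+x. ennreal ((cmod (f (t, x)))\<^sup>2) \<partial>lborel) \<le> ennreal C)"

text \<open>For the equations \<open>v\<close> is (1, 1): \<open>v \<bullet> t\<close> is the sum of
  the two times, and \<open>forward\<close> asks only that the total retardation be positive.
  \<open>k_supp\<close> encodes the start of the evolution, since the integral then sees the unknown
  only inside \<open>D\<close>.\<close>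

locale retarded_convolution =
  fixes \<nu> :: "('t::euclidean_space \<times> 'x::euclidean_space) measure"
    and D :: "'t set" and v :: 't and L :: real and k :: "'t \<times> 'x \<Rightarrow> complex" and B :: real
  assumes finite_nu: "finite_measure \<nu>"
    and sets_nu [measurable_cong]: "sets \<nu> = sets borel"
    and forward: "AE u in \<nu>. 0 < v \<bullet> fst u"
    and D_meas [measurable]: "D \<in> sets borel"
    and D_range: "\<And>t. t \<in> D \<Longrightarrow> 0 \<le> v \<bullet> t \<and> v \<bullet> t \<le> L"
    and k_meas [measurable]: "k \<in> borel_measurable borel"
    and k_bound: "\<And>p. cmod (k p) \<le> B"
    and k_supp: "\<And>p. fst p \<notin> D \<Longrightarrow> k p = 0"
begin

sublocale finite_measure \<nu> by (rule finite_nu)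

sublocale pair_lborel_nu: pair_sigma_finite "lborel :: 'x measure" \<nu> ..

sublocale pair_time_nu: pair_sigma_finite "lborel :: 't measure" \<nu> ..

definition volterra :: "('t \<times> 'x \<Rightarrow> complex) \<Rightarrow> 't \<times> 'x \<Rightarrow> complex" where
  "volterra \<xi> p = (\<integral>u. k (p - u) * \<xi> (p - u) \<partial>\<nu>)"

text \<open>The absolute-value companion of \<open>volterra\<close>. Being
  \<open>ennreal\<close>-valued it needs no integrability, so all norm estimates are proved for it
  and then transferred.\<close>

definition majorant :: "('t \<times> 'x \<Rightarrow> ennreal) \<Rightarrow> 't \<times> 'x \<Rightarrow> ennreal" where
  "majorant f p = (\<integral>\<^sup>+u. ennreal (cmod (k (p - u))) * f (p - u) \<partial>\<nu>)"

text \<open>A bound in an exponentially weighted (Bielecki) norm; the 2 in the exponent is there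
  because the slice norm is squared.\<close>

definition slice_bdd :: "real \<Rightarrow> ennreal \<Rightarrow> ('t \<times> 'x \<Rightarrow> ennreal) \<Rightarrow> bool" where
  "slice_bdd \<kappa> C f \<longleftrightarrow> (AE t in lborel. t \<in> D \<longrightarrow>
     (\<integral>\<^sup>+x. (f (t, x))\<^sup>2 \<partial>lborel) \<le> C * ennreal (exp (2 * \<kappa> * (v \<bullet> t))))"

text \<open>The Laplace transform at \<open>\<kappa>\<close> of the distribution of the total
  retardation under \<open>\<nu>\<close>.\<close>

definition exp_mass :: "real \<Rightarrow> ennreal" where
  "exp_mass \<kappa> = (\<integral>\<^sup>+u. ennreal (exp (- \<kappa> * (v \<bullet> fst u))) \<partial>\<nu>)"

lemma volterra_measurable [measurable]:
  assumes [measurable]: "\<xi> \<in> borel_measurable borel"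
  shows "volterra \<xi> \<in> borel_measurable borel"
  unfolding volterra_def[abs_def] by measurable

lemma majorant_measurable [measurable]:
  assumes [measurable]: "f \<in> borel_measurable borel"
  shows "majorant f \<in> borel_measurable borel"
  unfolding majorant_def[abs_def] by measurable

text \<open>Dominated convergence: finite mass makes the constant 1 integrable, and
  \<open>forward\<close> makes the integrand a power of a number below 1, almost everywhere.\<close>

lemma exp_mass_tendsto_0: "(\<lambda>n. exp_mass (real n)) \<longlonglongrightarrow> 0"
proof -
  have "(\<lambda>n. \<integral>\<^sup>+u. ennreal (exp (- real n * (v \<bullet> fst u))) \<partial>\<nu>) \<longlonglongrightarrow> (\<integral>\<^sup>+u. 0 \<partial>\<nu>)"
  proof (rule nn_integral_dominated_convergence[where w = "\<lambda>_. 1"])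
    show "AE u in \<nu>. ennreal (exp (- real n * (v \<bullet> fst u))) \<le> 1" for n
      using forward by eventually_elim simp
    show "(\<integral>\<^sup>+u. 1 \<partial>\<nu>) < \<infinity>"
      by (simp add: emeasure_finite less_top[symmetric])
    show "AE u in \<nu>. (\<lambda>n. ennreal (exp (- real n * (v \<bullet> fst u)))) \<longlonglongrightarrow> 0"
      using forward
    proof eventually_elim
      case (elim u)
      have "(\<lambda>n. exp (- (v \<bullet> fst u)) ^ n) \<longlonglongrightarrow> 0"
        using elim by (intro LIMSEQ_power_zero) auto
      then have "(\<lambda>n. exp (- real n * (v \<bullet> fst u))) \<longlonglongrightarrow> 0"
        by (simp add: exp_of_nat_mult[symmetric])
      then show ?case
        by (simp add: tendsto_ennreal_iff flip: ennreal_0)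
    qed
  qed measurable
  then show ?thesis
    by (simp add: exp_mass_def)
qed

text \<open>As bounds concern squares, 1/4 stands for a contraction factor 1/2. It is also exactly
  what makes the bound \<open>4 * C\<close> reproduce itself in
  \<open>solution_exists\<close>.\<close>

lemma exists_contraction_rate: "\<exists>\<kappa>\<ge>0. (ennreal B * exp_mass \<kappa>)\<^sup>2 \<le> 1 / 4"
proof -
  have "(\<lambda>n. (ennreal B * exp_mass (real n))\<^sup>2) \<longlonglongrightarrow> (ennreal B * 0)\<^sup>2"
    unfolding power2_eq_square
    by (intro tendsto_mult_ennreal ennreal_tendsto_cmult exp_mass_tendsto_0) auto
  moreover have "(0::ennreal) < 1 / 4"
    by (simp add: ennreal_zero_less_divide)
  ultimately have "eventually (\<lambda>n. (ennreal B * exp_mass (real n))\<^sup>2 < 1 / 4) sequentially"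
    by (intro order_tendstoD) auto
  then obtain n where "(ennreal B * exp_mass (real n))\<^sup>2 < 1 / 4"
    using eventually_happens trivial_limit_sequentially by blast
  then show ?thesis
    by (intro exI[of _ "real n"]) auto
qed

text \<open>Cauchy--Schwarz with the measure split as \<open>exp (- \<kappa> s / 2) \<cdot> exp (\<kappa> s / 2)\<close>, \<open>s = v \<bullet> fst u\<close>:
  the growth rate \<open>\<kappa>\<close> of the slice norms turns the second factor back into \<open>exp_mass \<kappa>\<close>.\<close>
lemma slice_bdd_majorant:
  assumes [measurable]: "f \<in> borel_measurable borel" and f: "slice_bdd \<kappa> C f"
  shows "slice_bdd \<kappa> ((ennreal B * exp_mass \<kappa>)\<^sup>2 * C) (majorant f)"
proof -
  define N where "N t = (\<integral>\<^sup>+x. (f (t, x))\<^sup>2 \<partial>lborel)" for t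
  have [measurable]: "N \<in> borel_measurable borel"
    unfolding N_def[abs_def] by measurable
  define Q where "Q t \<longleftrightarrow> (t \<in> D \<longrightarrow> N t \<le> C * ennreal (exp (2 * \<kappa> * (v \<bullet> t))))" for t
  have "AE t in lborel. Q t"
    using f by (simp add: slice_bdd_def Q_def N_def)
  \<comment> \<open>The hypothesis on \<open>f\<close> holds only for almost every time. Each
    translate of the exceptional set is again null, and exchanging the quantifiers makes
    \<open>\<nu>\<close>-almost every displacement harmless for almost every \<open>t\<close>, even
    if \<open>\<nu>\<close> is singular.\<close>
  then have "AE u in \<nu>. AE t in lborel. Q (t - fst u)"
    by (intro AE_I2[of \<nu>] AE_lborel_translate)
  moreover have "Measurable.pred (lborel \<Otimes>\<^sub>M \<nu>) (\<lambda>x. Q (fst x - fst (snd x)))"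
    unfolding Q_def by measurable
  ultimately have "AE t in lborel. AE u in \<nu>. Q (t - fst u)"
    by (subst pair_time_nu.AE_commute) (auto simp: pred_def)
  then show ?thesis
    unfolding slice_bdd_def
  proof eventually_elim
    case (elim t)
    define g where "g x u = ennreal (cmod (k ((t, x) - u))) * f ((t, x) - u)" for x u
    define w where "w c u = ennreal (exp (c * (v \<bullet> fst u)))" for c and u :: "'t \<times> 'x"
    have [measurable]: "w c \<in> borel_measurable \<nu>" for c
      unfolding w_def by measurable
    have [measurable]: "case_prod g \<in> borel_measurable (lborel \<Otimes>\<^sub>M \<nu>)"
      unfolding g_def by measurable
    have ww: "w c u * w e u = w (c + e) u" for c e u
      by (simp add: w_def ennreal_mult[symmetric] exp_add[symmetric] algebra_simps)
    have w0: "w 0 u = 1" for u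
      by (simp add: w_def)
    have w2: "(w c u)\<^sup>2 = w (2 * c) u" for c u
      using ww[of c u c] by (simp add: power2_eq_square)
    have "(majorant f (t, x))\<^sup>2 \<le> exp_mass \<kappa> * (\<integral>\<^sup>+u. w \<kappa> u * (g x u)\<^sup>2 \<partial>\<nu>)" for x
    proof -
      have "majorant f (t, x) = (\<integral>\<^sup>+u. w (- \<kappa> / 2) u * (w (\<kappa> / 2) u * g x u) \<partial>\<nu>)"
        by (simp add: majorant_def g_def mult.assoc[symmetric] ww w0)
      also have "(\<dots>)\<^sup>2 \<le> (\<integral>\<^sup>+u. (w (- \<kappa> / 2) u)\<^sup>2 \<partial>\<nu>) * (\<integral>\<^sup>+u. (w (\<kappa> / 2) u * g x u)\<^sup>2 \<partial>\<nu>)"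
        by (intro Cauchy_Schwarz_nn_integral) measurable
      also have "\<dots> = exp_mass \<kappa> * (\<integral>\<^sup>+u. w \<kappa> u * (g x u)\<^sup>2 \<partial>\<nu>)"
        by (simp add: power_mult_distrib w2) (simp add: exp_mass_def w_def)
      finally show ?thesis .
    qed
    then have "(\<integral>\<^sup>+x. (majorant f (t, x))\<^sup>2 \<partial>lborel) \<le> (\<integral>\<^sup>+x. exp_mass \<kappa> * (\<integral>\<^sup>+u. w \<kappa> u * (g x u)\<^sup>2 \<partial>\<nu>) \<partial>lborel)"
      by (intro nn_integral_mono)
    also have "\<dots> = exp_mass \<kappa> * (\<integral>\<^sup>+x. (\<integral>\<^sup>+u. w \<kappa> u * (g x u)\<^sup>2 \<partial>\<nu>) \<partial>lborel)"
      by (intro nn_integral_cmult) measurable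
    also have "(\<integral>\<^sup>+x. (\<integral>\<^sup>+u. w \<kappa> u * (g x u)\<^sup>2 \<partial>\<nu>) \<partial>lborel) = (\<integral>\<^sup>+u. (\<integral>\<^sup>+x. w \<kappa> u * (g x u)\<^sup>2 \<partial>lborel) \<partial>\<nu>)"
      by (intro pair_lborel_nu.Fubini'[symmetric]) measurable
    also have "\<dots> \<le> (\<integral>\<^sup>+u. ((ennreal B)\<^sup>2 * C * ennreal (exp (2 * \<kappa> * (v \<bullet> t)))) * w (- \<kappa>) u \<partial>\<nu>)"
    proof (rule nn_integral_mono_AE)
      show "AE u in \<nu>. (\<integral>\<^sup>+x. w \<kappa> u * (g x u)\<^sup>2 \<partial>lborel)
          \<le> ((ennreal B)\<^sup>2 * C * ennreal (exp (2 * \<kappa> * (v \<bullet> t)))) * w (- \<kappa>) u"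
        using elim
      proof eventually_elim
        case (elim u)
        obtain s y where u: "u = (s, y)" by (cases u)
        show ?case
        proof (cases "t - s \<in> D")
          \<comment> \<open>Outside \<open>D\<close> nothing is known about \<open>f\<close>, but
            there the kernel vanishes and with it the integrand.\<close>
          case False
          then show ?thesis
            by (simp add: g_def u k_supp)
        next
          case True
          have "(\<integral>\<^sup>+x. w \<kappa> u * (g x u)\<^sup>2 \<partial>lborel) = w \<kappa> u * (\<integral>\<^sup>+x. (g x u)\<^sup>2 \<partial>lborel)"
            by (intro nn_integral_cmult) (simp add: g_def u)
          also have "(\<integral>\<^sup>+x. (g x u)\<^sup>2 \<partial>lborel) \<le> (\<integral>\<^sup>+x. (ennreal B)\<^sup>2 * (f (t - s, x - y))\<^sup>2 \<partial>lborel)"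
            by (intro nn_integral_mono)
               (auto simp: g_def u power_mult_distrib intro!: mult_right_mono power_mono ennreal_leI k_bound)
          also have "\<dots> = (ennreal B)\<^sup>2 * N (t - s)"
            by (simp add: nn_integral_cmult nn_integral_lborel_translate[where f = "\<lambda>x. (f (t - s, x))\<^sup>2"] N_def)
          also have "\<dots> \<le> (ennreal B)\<^sup>2 * (C * ennreal (exp (2 * \<kappa> * (v \<bullet> (t - s)))))"
            using elim True by (intro mult_left_mono) (auto simp: Q_def u)
          also have "ennreal (exp (2 * \<kappa> * (v \<bullet> (t - s)))) = ennreal (exp (2 * \<kappa> * (v \<bullet> t))) * w (- 2 * \<kappa>) u"
            by (simp add: w_def u ennreal_mult[symmetric] exp_add[symmetric] inner_diff_right algebra_simps)
          finally have "(\<integral>\<^sup>+x. w \<kappa> u * (g x u)\<^sup>2 \<partial>lborel)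
              \<le> w \<kappa> u * ((ennreal B)\<^sup>2 * (C * (ennreal (exp (2 * \<kappa> * (v \<bullet> t))) * w (- 2 * \<kappa>) u)))"
            by (simp add: mult_left_mono)
          also have "\<dots> = ((ennreal B)\<^sup>2 * C * ennreal (exp (2 * \<kappa> * (v \<bullet> t)))) * (w \<kappa> u * w (- 2 * \<kappa>) u)"
            by (simp only: ac_simps)
          finally show ?thesis
            by (simp add: ww)
        qed
      qed
    qed
    also have "\<dots> = (ennreal B)\<^sup>2 * C * ennreal (exp (2 * \<kappa> * (v \<bullet> t))) * exp_mass \<kappa>"
      by (subst nn_integral_cmult) (simp_all add: exp_mass_def w_def[abs_def])
    finally have "(\<integral>\<^sup>+x. (majorant f (t, x))\<^sup>2 \<partial>lborel)
        \<le> exp_mass \<kappa> * ((ennreal B)\<^sup>2 * C * ennreal (exp (2 * \<kappa> * (v \<bullet> t))) * exp_mass \<kappa>)"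
      by (simp add: mult_left_mono)
    then show ?case
      by (simp add: power2_eq_square ac_simps)
  qed
qed


section \<open>Calculus of slice bounds\<close>

lemma slice_bdd_mono_AE:
  assumes g: "slice_bdd \<kappa> C g"
    and le: "AE p in lborel. fst p \<in> D \<longrightarrow> f p \<le> g p"
  shows "slice_bdd \<kappa> C f"
proof -
  have "AE t in lborel. AE x in lborel. t \<in> D \<longrightarrow> f (t, x) \<le> g (t, x)"
    using AE_lborel_pairD[OF le] by simp
  then show ?thesis
    using g unfolding slice_bdd_def
  proof eventually_elim
    case (elim t)
    show ?case
    proof
      assume t: "t \<in> D"
      have "(\<integral>\<^sup>+x. (f (t, x))\<^sup>2 \<partial>lborel) \<le> (\<integral>\<^sup>+x. (g (t, x))\<^sup>2 \<partial>lborel)"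
        using elim(1) t by (intro nn_integral_mono_AE) (auto elim!: eventually_mono intro!: power_mono)
      then show "(\<integral>\<^sup>+x. (f (t, x))\<^sup>2 \<partial>lborel) \<le> C * ennreal (exp (2 * \<kappa> * (v \<bullet> t)))"
        using elim(2) t by (auto intro: order_trans)
    qed
  qed
qed

lemma slice_bdd_const_mono: "slice_bdd \<kappa> C f \<Longrightarrow> C \<le> C' \<Longrightarrow> slice_bdd \<kappa> C' f"
  unfolding slice_bdd_def
  by (erule eventually_mono) (meson mult_right_mono order_trans zero_le)

lemma slice_bdd_add:
  assumes [measurable]: "f \<in> borel_measurable borel" "g \<in> borel_measurable borel"
    and f: "slice_bdd \<kappa> C f" and g: "slice_bdd \<kappa> C' g"
  shows "slice_bdd \<kappa> (2 * C + 2 * C') (\<lambda>p. f p + g p)"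
  using f g unfolding slice_bdd_def
proof eventually_elim
  case (elim t)
  show ?case
  proof
    assume t: "t \<in> D"
    have "(\<integral>\<^sup>+x. (f (t, x) + g (t, x))\<^sup>2 \<partial>lborel)
        \<le> (\<integral>\<^sup>+x. 2 * (f (t, x))\<^sup>2 + 2 * (g (t, x))\<^sup>2 \<partial>lborel)"
      by (intro nn_integral_mono ennreal_sum_squared_le)
    also have "\<dots> = 2 * (\<integral>\<^sup>+x. (f (t, x))\<^sup>2 \<partial>lborel) + 2 * (\<integral>\<^sup>+x. (g (t, x))\<^sup>2 \<partial>lborel)"
      by (simp add: nn_integral_add nn_integral_cmult)
    also have "\<dots> \<le> 2 * (C * ennreal (exp (2 * \<kappa> * (v \<bullet> t)))) + 2 * (C' * ennreal (exp (2 * \<kappa> * (v \<bullet> t))))"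
      using elim t by (intro add_mono mult_left_mono) auto
    finally show "(\<integral>\<^sup>+x. (f (t, x) + g (t, x))\<^sup>2 \<partial>lborel)
        \<le> (2 * C + 2 * C') * ennreal (exp (2 * \<kappa> * (v \<bullet> t)))"
      by (simp add: distrib_right mult.assoc)
  qed
qed

lemma slice_bdd_imp_AE_finite:
  assumes [measurable]: "f \<in> borel_measurable borel"
    and f: "slice_bdd \<kappa> C f" and C: "C < \<infinity>"
  shows "AE p in lborel. fst p \<in> D \<longrightarrow> f p < \<infinity>"
proof -
  have "AE t in lborel. AE x in lborel. t \<in> D \<longrightarrow> f (t, x) < \<infinity>"
    using f unfolding slice_bdd_def
  proof eventually_elim
    case (elim t)
    show ?case
    proof (cases "t \<in> D")
      case True
      then have "(\<integral>\<^sup>+x. (f (t, x))\<^sup>2 \<partial>lborel) < \<infinity>"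
        using elim C by (auto simp: ennreal_mult_less_top intro: le_less_trans)
      then have "AE x in lborel. (f (t, x))\<^sup>2 \<noteq> \<infinity>"
        by (intro nn_integral_PInf_AE) auto
      then show ?thesis
        by eventually_elim (auto simp: less_top[symmetric] power_eq_top_ennreal)
    qed simp
  qed
  then show ?thesis
    by (intro AE_lborel_pairI) simp_all
qed

lemma slice_bdd_0_imp_AE_0:
  assumes [measurable]: "f \<in> borel_measurable borel"
    and f: "slice_bdd \<kappa> 0 f"
  shows "AE p in lborel. fst p \<in> D \<longrightarrow> f p = 0"
proof -
  have "AE t in lborel. AE x in lborel. t \<in> D \<longrightarrow> f (t, x) = 0"
    using f unfolding slice_bdd_def
  proof eventually_elim
    case (elim t)
    show ?case
    proof (cases "t \<in> D")
      case True
      then have "(\<integral>\<^sup>+x. (f (t, x))\<^sup>2 \<partial>lborel) = 0"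
        using elim by auto
      then show ?thesis
        by (simp add: nn_integral_0_iff_AE)
    qed simp
  qed
  then show ?thesis
    by (intro AE_lborel_pairI) simp_all
qed

section \<open>Pointwise control of the Volterra operator by its majorant\<close>

lemma integrable_volterra:
  assumes [measurable]: "\<xi> \<in> borel_measurable borel"
    and "majorant (\<lambda>p. ennreal (cmod (\<xi> p))) p < \<infinity>"
  shows "integrable \<nu> (\<lambda>u. k (p - u) * \<xi> (p - u))"
  using assms(2) by (intro integrableI_bounded) (auto simp: majorant_def norm_mult ennreal_mult)

text \<open>True at every point: where the Bochner integral does not exist, its value is 0 by
  convention.\<close>

lemma norm_volterra_le_majorant:
  "ennreal (cmod (volterra \<xi> p)) \<le> majorant (\<lambda>p. ennreal (cmod (\<xi> p))) p"
proof (cases "integrable \<nu> (\<lambda>u. k (p - u) * \<xi> (p - u))")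
  case True
  then show ?thesis
    using integral_norm_bound_ennreal[OF True] by (simp add: volterra_def majorant_def norm_mult ennreal_mult)
qed (simp add: volterra_def not_integrable_integral_eq)

text \<open>By \<open>k_supp\<close> the values outside \<open>D\<close> never enter, so it is
  immaterial how a solution is extended beyond \<open>D\<close>.\<close>

lemma volterra_cong:
  assumes "\<And>q. fst q \<in> D \<Longrightarrow> \<xi> q = \<zeta> q"
  shows "volterra \<xi> = volterra \<zeta>"
proof
  fix p
  have "k q * \<xi> q = k q * \<zeta> q" for q
    by (cases "fst q \<in> D") (auto simp: assms k_supp)
  then show "volterra \<xi> p = volterra \<zeta> p"
    unfolding volterra_def by (simp only:)
qed

lemma majorant_mono: "(\<And>p. f p \<le> g p) \<Longrightarrow> majorant f p \<le> majorant g p"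
  unfolding majorant_def by (intro nn_integral_mono mult_left_mono) auto

text \<open>Gives absolute convergence of the Volterra integral at almost every point of
  \<open>D\<close>, which is what allows linearity to be used pointwise.\<close>

lemma AE_majorant_finite:
  assumes [measurable]: "f \<in> borel_measurable borel"
    and f: "slice_bdd \<kappa> C f" and C: "C < \<infinity>" and rate: "(ennreal B * exp_mass \<kappa>)\<^sup>2 \<le> 1 / 4"
  shows "AE p in lborel. fst p \<in> D \<longrightarrow> majorant f p < \<infinity>"
proof (rule slice_bdd_imp_AE_finite[OF _ slice_bdd_majorant[OF _ f]])
  have "(ennreal B * exp_mass \<kappa>)\<^sup>2 < \<infinity>"
    using rate by (rule le_less_trans) (simp add: divide_ennreal_def ennreal_mult_less_top less_top[symmetric])
  then show "(ennreal B * exp_mass \<kappa>)\<^sup>2 * C < \<infinity>"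
    using C by (auto simp: ennreal_mult_less_top)
qed measurable

section \<open>Uniqueness and existence by iteration\<close>

theorem solution_unique:
  assumes [measurable]: "\<xi> \<in> borel_measurable borel" "\<zeta> \<in> borel_measurable borel"
    and b1: "slice_bdd \<kappa> C (\<lambda>p. ennreal (cmod (\<xi> p)))" and b2: "slice_bdd \<kappa> C' (\<lambda>p. ennreal (cmod (\<zeta> p)))"
    and fin: "C < \<infinity>" "C' < \<infinity>" and rate: "(ennreal B * exp_mass \<kappa>)\<^sup>2 \<le> 1 / 4"
    and s1: "AE p in lborel. fst p \<in> D \<longrightarrow> \<xi> p = f p + volterra \<xi> p"
    and s2: "AE p in lborel. fst p \<in> D \<longrightarrow> \<zeta> p = f p + volterra \<zeta> p"
  shows "AE p in lborel. fst p \<in> D \<longrightarrow> \<xi> p = \<zeta> p"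
proof -
  define \<delta> where "\<delta> p = \<xi> p - \<zeta> p" for p
  have [measurable]: "\<delta> \<in> borel_measurable borel"
    unfolding \<delta>_def by measurable
  \<comment> \<open>The source \<open>f\<close> cancels in the difference. Pulling the subtraction
    into the integral requires both integrals to converge, hence the two finiteness facts.\<close>
  have "AE p in lborel. fst p \<in> D \<longrightarrow> ennreal (cmod (\<delta> p)) \<le> majorant (\<lambda>p. ennreal (cmod (\<delta> p))) p"
    using AE_majorant_finite[OF _ b1 fin(1) rate, simplified] AE_majorant_finite[OF _ b2 fin(2) rate, simplified] s1 s2
  proof eventually_elim
    case (elim p)
    show ?case
    proof
      assume p: "fst p \<in> D"
      have "\<delta> p = volterra \<xi> p - volterra \<zeta> p"
        using elim p by (simp add: \<delta>_def)
      also have "\<dots> = volterra \<delta> p"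
        using elim p unfolding volterra_def \<delta>_def right_diff_distrib
        by (subst Bochner_Integration.integral_diff) (auto intro!: integrable_volterra)
      finally show "ennreal (cmod (\<delta> p)) \<le> majorant (\<lambda>p. ennreal (cmod (\<delta> p))) p"
        using norm_volterra_le_majorant[of \<delta> p] by simp
    qed
  qed
  note le = this
  define E where "E = 2 * C + 2 * C'"
  have E: "E < \<infinity>"
    using fin by (simp add: E_def ennreal_mult_less_top)
  have "slice_bdd \<kappa> E (\<lambda>p. ennreal (cmod (\<xi> p)) + ennreal (cmod (\<zeta> p)))"
    unfolding E_def by (intro slice_bdd_add b1 b2) measurable
  then have 0: "slice_bdd \<kappa> E (\<lambda>p. ennreal (cmod (\<delta> p)))"
    by (rule slice_bdd_mono_AE)
       (auto intro!: AE_I2 ennreal_leI norm_triangle_ineq4 simp: \<delta>_def simp flip: ennreal_plus)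
  \<comment> \<open>The inequality \<open>le\<close> bounds \<open>\<delta>\<close> by its own
    majorant, so every application improves the bound on the same function by the factor
    1/4.\<close>
  have n: "slice_bdd \<kappa> ((1 / 4) ^ n * E) (\<lambda>p. ennreal (cmod (\<delta> p)))" for n
  proof (induction n)
    case (Suc n)
    have "slice_bdd \<kappa> ((ennreal B * exp_mass \<kappa>)\<^sup>2 * ((1 / 4) ^ n * E)) (majorant (\<lambda>p. ennreal (cmod (\<delta> p))))"
      by (rule slice_bdd_majorant[OF _ Suc]) measurable
    then have "slice_bdd \<kappa> ((ennreal B * exp_mass \<kappa>)\<^sup>2 * ((1 / 4) ^ n * E)) (\<lambda>p. ennreal (cmod (\<delta> p)))"
      by (rule slice_bdd_mono_AE[OF _ le])
    then show ?case
      by (rule slice_bdd_const_mono) (auto simp: mult.assoc intro!: mult_right_mono rate)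
  qed (use 0 in simp)
  have "slice_bdd \<kappa> 0 (\<lambda>p. ennreal (cmod (\<delta> p)))"
  proof -
    \<comment> \<open>Countably many exceptional sets are merged into one before \<open>n\<close>
      tends to infinity.\<close>
    have "AE t in lborel. \<forall>n. t \<in> D \<longrightarrow>
        (\<integral>\<^sup>+x. (ennreal (cmod (\<delta> (t, x))))\<^sup>2 \<partial>lborel) \<le> (1 / 4) ^ n * E * ennreal (exp (2 * \<kappa> * (v \<bullet> t)))"
      using n unfolding slice_bdd_def AE_all_countable by blast
    then show ?thesis
      unfolding slice_bdd_def
    proof eventually_elim
      case (elim t)
      have "(\<lambda>n. (1 / 4 :: ennreal) ^ n) \<longlonglongrightarrow> 0"
      proof -
        have "(\<lambda>n. (1 / 4 :: real) ^ n) \<longlonglongrightarrow> 0"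
          by (intro LIMSEQ_power_zero) auto
        moreover have "(1 / 4 :: ennreal) ^ n = ennreal ((1 / 4) ^ n)" for n
          by (simp add: ennreal_power[symmetric] divide_ennreal[symmetric])
        ultimately show ?thesis
          by (simp add: tendsto_ennreal_iff flip: ennreal_0)
      qed
      then have "(\<lambda>n. (1 / 4 :: ennreal) ^ n * (E * ennreal (exp (2 * \<kappa> * (v \<bullet> t))))) \<longlonglongrightarrow> 0 * (E * ennreal (exp (2 * \<kappa> * (v \<bullet> t))))"
        using E by (intro tendsto_mult_ennreal tendsto_const) (auto simp: ennreal_mult_eq_top_iff)
      then have "(\<integral>\<^sup>+x. (ennreal (cmod (\<delta> (t, x))))\<^sup>2 \<partial>lborel) \<le> 0" if "t \<in> D"
        using elim that by (intro LIMSEQ_le_const) (auto simp: mult.assoc)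
      then show ?case
        by simp
    qed
  qed
  then have "AE p in lborel. fst p \<in> D \<longrightarrow> ennreal (cmod (\<delta> p)) = 0"
    by (intro slice_bdd_0_imp_AE_0) measurable
  then show ?thesis
    by eventually_elim (simp add: \<delta>_def)
qed

theorem solution_exists:
  assumes [measurable]: "f \<in> borel_measurable borel"
    and f: "slice_bdd \<kappa> C (\<lambda>p. ennreal (cmod (f p)))" and C: "C < \<infinity>"
    and rate: "(ennreal B * exp_mass \<kappa>)\<^sup>2 \<le> 1 / 4"
  obtains \<xi> where "\<xi> \<in> borel_measurable borel" "slice_bdd \<kappa> (4 * C) (\<lambda>p. ennreal (cmod (\<xi> p)))"
    "AE p in lborel. fst p \<in> D \<longrightarrow> \<xi> p = f p + volterra \<xi> p"
proof -
  \<comment> \<open>The terms of the Neumann series are \<open>e n\<close>; the \<open>d n\<close>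
    dominate them and are summed without any convergence question. Where their sum \<open>F\<close>
    is infinite, \<open>\<xi>\<close> may take an arbitrary default value.\<close>
  define e where "e n = (volterra ^^ n) f" for n
  define d where "d n = (majorant ^^ n) (\<lambda>p. ennreal (cmod (f p)))" for n
  define S where "S n p = (\<Sum>i<n. d i p)" for n p
  define F where "F p = (\<Sum>i. d i p)" for p
  define \<xi> where "\<xi> p = (\<Sum>i. e i p)" for p
  have e0: "e 0 = f" and eS: "e (Suc n) = volterra (e n)" for n
    by (simp_all add: e_def)
  have d0: "d 0 = (\<lambda>p. ennreal (cmod (f p)))" and dS: "d (Suc n) = majorant (d n)" for n
    by (simp_all add: d_def)
  have [measurable]: "e n \<in> borel_measurable borel" for n
    by (induction n) (simp_all add: e0 eS)
  have [measurable]: "d n \<in> borel_measurable borel" for n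
    by (induction n) (simp_all add: d0 dS)
  have [measurable]: "S n \<in> borel_measurable borel" for n
    unfolding S_def by measurable
  have [measurable]: "F \<in> borel_measurable borel"
    unfolding F_def by measurable
  have xi_meas [measurable]: "\<xi> \<in> borel_measurable borel"
    unfolding \<xi>_def by measurable
  have ed: "ennreal (cmod (e n p)) \<le> d n p" for n p
  proof (induction n arbitrary: p)
    case (Suc n)
    show ?case
      unfolding eS dS by (rule order_trans[OF norm_volterra_le_majorant majorant_mono[OF Suc]])
  qed (simp add: e0 d0)
  \<comment> \<open>This affine recursion lets one induction bound all partial sums at once, instead
    of estimating the terms and summing a geometric series of norms.\<close>
  have S_Suc: "S (Suc n) = (\<lambda>p. ennreal (cmod (f p)) + majorant (S n) p)" for n
  proof
    fix p
    have "majorant (S n) p = (\<Sum>i<n. majorant (d i) p)"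
      unfolding majorant_def S_def sum_distrib_left by (rule nn_integral_sum) measurable
    then show "S (Suc n) p = ennreal (cmod (f p)) + majorant (S n) p"
      unfolding S_def sum.lessThan_Suc_shift by (simp add: d0 dS)
  qed
  \<comment> \<open>The value \<open>4 * C\<close> is the fixed point of x = 2C + 2(1/4)x, the
    recursion that \<open>slice_bdd_add\<close> and the contraction rate produce.\<close>
  have Sb: "slice_bdd \<kappa> (4 * C) (S n)" for n
  proof (induction n)
    case 0
    then show ?case
      by (simp add: S_def slice_bdd_def)
  next
    case (Suc n)
    have "slice_bdd \<kappa> (2 * C + 2 * ((ennreal B * exp_mass \<kappa>)\<^sup>2 * (4 * C))) (S (Suc n))"
      unfolding S_Suc by (intro slice_bdd_add f slice_bdd_majorant Suc) measurable
    then show ?case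
    proof (rule slice_bdd_const_mono)
      have "(ennreal B * exp_mass \<kappa>)\<^sup>2 * (4 * C) \<le> 1 / 4 * (4 * C)"
        by (intro mult_right_mono rate) auto
      also have "\<dots> = C"
        by (simp add: mult.assoc[symmetric] ennreal_divide_times)
      finally have "2 * C + 2 * ((ennreal B * exp_mass \<kappa>)\<^sup>2 * (4 * C)) \<le> 2 * C + 2 * C"
        by (intro add_left_mono mult_left_mono) auto
      also have "\<dots> = 4 * C"
        by (simp add: distrib_right[symmetric])
      finally show "2 * C + 2 * ((ennreal B * exp_mass \<kappa>)\<^sup>2 * (4 * C)) \<le> 4 * C" .
    qed
  qed
  have S_lim: "(\<lambda>n. S n p) \<longlonglongrightarrow> F p" for p
    unfolding S_def F_def by (rule summable_LIMSEQ) simp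
  have S_inc: "incseq (\<lambda>n. S n p)" for p
    unfolding S_def by (intro incseq_SucI) simp
  have Fb: "slice_bdd \<kappa> (4 * C) F"
  proof -
    have "AE t in lborel. \<forall>n. t \<in> D \<longrightarrow>
        (\<integral>\<^sup>+x. (S n (t, x))\<^sup>2 \<partial>lborel) \<le> 4 * C * ennreal (exp (2 * \<kappa> * (v \<bullet> t)))"
      using Sb unfolding slice_bdd_def AE_all_countable by blast
    then show ?thesis
      unfolding slice_bdd_def
    proof eventually_elim
      case (elim t)
      have "(\<lambda>n. \<integral>\<^sup>+x. (S n (t, x))\<^sup>2 \<partial>lborel) \<longlonglongrightarrow> (\<integral>\<^sup>+x. (F (t, x))\<^sup>2 \<partial>lborel)"
      proof (rule nn_integral_LIMSEQ)
        show "incseq (\<lambda>n x. (S n (t, x))\<^sup>2)"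
          using S_inc by (auto simp: incseq_def le_fun_def intro!: power_mono)
        show "(\<lambda>n. (S n (t, x))\<^sup>2) \<longlonglongrightarrow> (F (t, x))\<^sup>2" for x
          unfolding power2_eq_square by (intro tendsto_mult_ennreal S_lim) auto
      qed measurable
      then show ?case
        using elim by (auto intro: LIMSEQ_le_const2)
    qed
  qed
  have xi_F: "ennreal (cmod (\<xi> p)) \<le> F p" for p
  proof (cases "F p = \<infinity>")
    case False
    have le: "(\<Sum>i. ennreal (cmod (e i p))) \<le> F p"
      unfolding F_def by (intro suminf_le ed) auto
    then have sm: "summable (\<lambda>i. cmod (e i p))"
      using False by (intro summable_suminf_not_top) (auto simp: top_unique)
    have "ennreal (cmod (\<xi> p)) \<le> ennreal (\<Sum>i. cmod (e i p))"
      unfolding \<xi>_def by (intro ennreal_leI summable_norm sm)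
    also have "\<dots> = (\<Sum>i. ennreal (cmod (e i p)))"
      using sm by (intro suminf_ennreal2[symmetric]) auto
    finally show ?thesis
      using le by (rule order_trans)
  qed simp
  have sol: "\<xi> p = f p + volterra \<xi> p" if p: "F p < \<infinity>" for p
  proof -
    have "(\<Sum>i. ennreal (cmod (e i p))) \<le> F p"
      unfolding F_def by (intro suminf_le ed) auto
    with p have sum_e: "summable (\<lambda>i. e i p)"
      by (intro summable_norm_cancel[OF summable_suminf_not_top]) (auto simp: top_unique)
    define h where "h i u = k (p - u) * e i (p - u)" for i u
    have [measurable]: "h i \<in> borel_measurable \<nu>" for i
      unfolding h_def by measurable
    have nn_h: "(\<integral>\<^sup>+u. ennreal (cmod (h i u)) \<partial>\<nu>) \<le> d (Suc i) p" for i
      unfolding dS majorant_def h_def norm_mult ennreal_mult[OF norm_ge_zero norm_ge_zero]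
      by (intro nn_integral_mono mult_left_mono ed) auto
    \<comment> \<open>The tail of \<open>F p\<close> dominates the sum of the integrals of the
      \<open>cmod (h i u)\<close>. Finiteness at this single point thus yields all hypotheses of
      \<open>integral_suminf\<close>, with no new exceptional set of base points.\<close>
    have "(\<Sum>i. d (Suc i) p) \<le> F p"
      unfolding F_def by (subst suminf_offset[of "\<lambda>i. d i p" 1]) auto
    then have dfin: "(\<Sum>i. d (Suc i) p) < \<infinity>"
      using p by (rule le_less_trans)
    then have sfin: "(\<Sum>i. \<integral>\<^sup>+u. ennreal (cmod (h i u)) \<partial>\<nu>) < \<infinity>"
      by (rule le_less_trans[rotated]) (intro suminf_le nn_h, auto)
    have int_h: "integrable \<nu> (h i)" for i
    proof (rule integrableI_bounded)
      have "(\<integral>\<^sup>+u. ennreal (cmod (h i u)) \<partial>\<nu>) \<le> (\<Sum>i. \<integral>\<^sup>+u. ennreal (cmod (h i u)) \<partial>\<nu>)"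
        using sum_le_suminf[of "\<lambda>i. \<integral>\<^sup>+u. ennreal (cmod (h i u)) \<partial>\<nu>" "{i}"] by simp
      then show "(\<integral>\<^sup>+u. ennreal (cmod (h i u)) \<partial>\<nu>) < \<infinity>"
        using sfin by (rule le_less_trans)
    qed measurable
    have "(\<integral>\<^sup>+u. (\<Sum>i. ennreal (cmod (h i u))) \<partial>\<nu>) < \<infinity>"
      using sfin by (subst nn_integral_suminf) auto
    then have "AE u in \<nu>. (\<Sum>i. ennreal (cmod (h i u))) \<noteq> \<infinity>"
      by (intro nn_integral_PInf_AE) auto
    then have sum_h: "AE u in \<nu>. summable (\<lambda>i. cmod (h i u))"
      by eventually_elim (auto intro: summable_suminf_not_top)
    have sum_int: "summable (\<lambda>i. \<integral>u. cmod (h i u) \<partial>\<nu>)"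
      using sfin int_h by (intro summable_suminf_not_top) (auto simp: nn_integral_eq_integral)
    have "\<xi> p = e 0 p + (\<Sum>i. e (Suc i) p)"
      unfolding \<xi>_def using suminf_split_head[OF sum_e] by simp
    also have "(\<Sum>i. e (Suc i) p) = (\<Sum>i. \<integral>u. h i u \<partial>\<nu>)"
      by (simp add: eS volterra_def h_def)
    also have "\<dots> = (\<integral>u. (\<Sum>i. h i u) \<partial>\<nu>)"
      by (intro integral_suminf[symmetric] int_h sum_h sum_int)
    also have "\<dots> = volterra \<xi> p"
      unfolding volterra_def
    proof (rule integral_cong_AE)
      show "AE u in \<nu>. (\<Sum>i. h i u) = k (p - u) * \<xi> (p - u)"
        using sum_h
      proof eventually_elim
        case (elim u)
        then have "summable (\<lambda>i. h i u)"
          by (rule summable_norm_cancel)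
        \<comment> \<open>If the kernel vanishes, the series of the \<open>e i (p - u)\<close> may
          diverge, but both sides are 0; otherwise the kernel can be divided out of the
          summability.\<close>
        then show ?case
          by (cases "k (p - u) = 0") (auto simp: h_def \<xi>_def summable_cmult_iff suminf_mult)
      qed
    qed measurable
    finally show ?thesis
      by (simp add: e0)
  qed
  have "AE p in lborel. fst p \<in> D \<longrightarrow> F p < \<infinity>"
    using C by (intro slice_bdd_imp_AE_finite[OF _ Fb]) (auto simp: ennreal_mult_less_top)
  then have "AE p in lborel. fst p \<in> D \<longrightarrow> \<xi> p = f p + volterra \<xi> p"
    by eventually_elim (simp add: sol)
  moreover have "slice_bdd \<kappa> (4 * C) (\<lambda>p. ennreal (cmod (\<xi> p)))"
    by (rule slice_bdd_mono_AE[OF Fb]) (simp add: xi_F)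
  ultimately show ?thesis
    using xi_meas that by blast
qed


section \<open>Equivalence of uniform and exponentially weighted bounds; the well-posedness
  theorem\<close>

lemma bounded_slices_imp_slice_bdd:
  assumes "bounded_slices D f" and "0 \<le> \<kappa>"
  obtains C where "C < \<infinity>" "slice_bdd \<kappa> C (\<lambda>p. ennreal (cmod (f p)))"
proof -
  obtain C :: real where C: "AE t in lborel. t \<in> D \<longrightarrow>
      (\<integral>\<^sup>+x. ennreal ((cmod (f (t, x)))\<^sup>2) \<partial>lborel) \<le> ennreal C"
    using assms(1) by (auto simp: bounded_slices_def)
  have "slice_bdd \<kappa> (ennreal C) (\<lambda>p. ennreal (cmod (f p)))"
    using C unfolding slice_bdd_def
  proof eventually_elim
    case (elim t)
    show ?case
    proof
      assume t: "t \<in> D"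
      then have "ennreal C * 1 \<le> ennreal C * ennreal (exp (2 * \<kappa> * (v \<bullet> t)))"
        using D_range[of t] \<open>0 \<le> \<kappa>\<close> by (intro mult_left_mono) auto
      then show "(\<integral>\<^sup>+x. (ennreal (cmod (f (t, x))))\<^sup>2 \<partial>lborel) \<le> ennreal C * ennreal (exp (2 * \<kappa> * (v \<bullet> t)))"
        using elim t by (simp add: ennreal_power)
    qed
  qed
  then show ?thesis
    by (intro that[of "ennreal C"]) auto
qed

text \<open>On \<open>D\<close> the weight lies between 1 and \<open>exp (2 * \<kappa> * L)\<close>.
  The lower bound gave the preceding lemma, the upper one gives this.\<close>

lemma slice_bdd_imp_bounded_slices:
  assumes f: "slice_bdd \<kappa> C (\<lambda>p. ennreal (cmod (f p)))" and C: "C < \<infinity>" and "0 \<le> \<kappa>"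
  shows "bounded_slices D f"
proof -
  obtain c where c: "C = ennreal c" "0 \<le> c"
    using C by (cases C) auto
  have "AE t in lborel. t \<in> D \<longrightarrow>
      (\<integral>\<^sup>+x. ennreal ((cmod (f (t, x)))\<^sup>2) \<partial>lborel) \<le> ennreal (c * exp (2 * \<kappa> * L))"
    using f unfolding slice_bdd_def
  proof eventually_elim
    case (elim t)
    show ?case
    proof
      assume t: "t \<in> D"
      have "C * ennreal (exp (2 * \<kappa> * (v \<bullet> t))) \<le> C * ennreal (exp (2 * \<kappa> * L))"
        using D_range[OF t] \<open>0 \<le> \<kappa>\<close> by (intro mult_left_mono ennreal_leI) (auto intro!: mult_left_mono)
      also have "\<dots> = ennreal (c * exp (2 * \<kappa> * L))"
        using c by (simp add: ennreal_mult)
      finally show "(\<integral>\<^sup>+x. ennreal ((cmod (f (t, x)))\<^sup>2) \<partial>lborel) \<le> ennreal (c * exp (2 * \<kappa> * L))"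
        using elim t by (simp add: ennreal_power)
    qed
  qed
  then show ?thesis
    unfolding bounded_slices_def by blast
qed

theorem unique_solution:
  assumes f [measurable]: "f \<in> borel_measurable borel" and fb: "bounded_slices D f"
  shows "\<exists>\<xi>\<in>borel_measurable borel. bounded_slices D \<xi> \<and>
    (AE p in lborel. fst p \<in> D \<longrightarrow> \<xi> p = f p + volterra \<xi> p) \<and>
    (\<forall>\<zeta>\<in>borel_measurable borel. bounded_slices D \<zeta> \<longrightarrow>
       (AE p in lborel. fst p \<in> D \<longrightarrow> \<zeta> p = f p + volterra \<zeta> p) \<longrightarrow>
       (AE p in lborel. fst p \<in> D \<longrightarrow> \<zeta> p = \<xi> p))"
proof -
  \<comment> \<open>The rate depends only on \<open>B\<close> and \<open>\<nu>\<close>, so the same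
    \<open>\<kappa>\<close> serves every competitor \<open>\<zeta>\<close>, however large its
    bound.\<close>
  obtain \<kappa> where \<kappa>: "0 \<le> \<kappa>" and rate: "(ennreal B * exp_mass \<kappa>)\<^sup>2 \<le> 1 / 4"
    using exists_contraction_rate by blast
  obtain C where C: "C < \<infinity>" "slice_bdd \<kappa> C (\<lambda>p. ennreal (cmod (f p)))"
    using bounded_slices_imp_slice_bdd[OF fb \<kappa>] .
  obtain \<xi> where \<xi>: "\<xi> \<in> borel_measurable borel" "slice_bdd \<kappa> (4 * C) (\<lambda>p. ennreal (cmod (\<xi> p)))"
    "AE p in lborel. fst p \<in> D \<longrightarrow> \<xi> p = f p + volterra \<xi> p"
    using solution_exists[OF f C(2,1) rate] .
  have C4: "4 * C < \<infinity>"
    using C(1) by (simp add: ennreal_mult_less_top)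
  show ?thesis
  proof (intro bexI[of _ \<xi>] conjI ballI impI)
    show "bounded_slices D \<xi>"
      using slice_bdd_imp_bounded_slices[OF \<xi>(2) C4 \<kappa>] .
    fix \<zeta>
    assume \<zeta>: "\<zeta> \<in> borel_measurable borel" "bounded_slices D \<zeta>"
      "AE p in lborel. fst p \<in> D \<longrightarrow> \<zeta> p = f p + volterra \<zeta> p"
    obtain C' where C': "C' < \<infinity>" "slice_bdd \<kappa> C' (\<lambda>p. ennreal (cmod (\<zeta> p)))"
      using bounded_slices_imp_slice_bdd[OF \<zeta>(2) \<kappa>] .
    show "AE p in lborel. fst p \<in> D \<longrightarrow> \<zeta> p = \<xi> p"
      by (rule solution_unique[OF \<zeta>(1) \<xi>(1) C'(2) \<xi>(2) C'(1) C4 rate \<zeta>(3) \<xi>(3)])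
  qed (use \<xi> in auto)
qed

end

section \<open>Reduction of the integral equation to a convolution equation\<close>

text \<open>Fields list their arguments particle by particle, whereas slices require all times to be
  separated from all positions.\<close>

definition regroup :: "real \<times> (real^'n) \<times> real \<times> (real^'n) \<Rightarrow> (real \<times> real) \<times> (real^'n::finite) \<times> (real^'n)" where
  "regroup = (\<lambda>(\<eta>1, x1, \<eta>2, x2). ((\<eta>1, \<eta>2), (x1, x2)))"

definition ungroup :: "(real \<times> real) \<times> (real^'n) \<times> (real^'n) \<Rightarrow> real \<times> (real^'n::finite) \<times> real \<times> (real^'n)" where
  "ungroup = (\<lambda>((\<eta>1, \<eta>2), (x1, x2)). (\<eta>1, x1, \<eta>2, x2))"

lemma regroup_simps [simp]:
  "regroup (\<eta>1, x1, \<eta>2, x2) = ((\<eta>1, \<eta>2), (x1, x2))"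
  "ungroup ((\<eta>1, \<eta>2), (x1, x2)) = (\<eta>1, x1, \<eta>2, x2)"
  "regroup (ungroup q) = q" "ungroup (regroup p) = p"
  by (auto simp: regroup_def ungroup_def split: prod.splits)

lemma regroup_measurable [measurable]: "regroup \<in> borel_measurable borel"
  unfolding regroup_def case_prod_beta by measurable

lemma ungroup_measurable [measurable]: "ungroup \<in> borel_measurable borel"
  unfolding ungroup_def case_prod_beta by measurable

section \<open>Invariance of Lebesgue measure under regrouping of coordinates\<close>

lemma nn_integral_lborel_pair:
  fixes f :: "'a::euclidean_space \<times> 'b::euclidean_space \<Rightarrow> ennreal"
  assumes "f \<in> borel_measurable borel"
  shows "(\<integral>\<^sup>+p. f p \<partial>lborel) = (\<integral>\<^sup>+x. \<integral>\<^sup>+y. f (x, y) \<partial>lborel \<partial>lborel)"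
proof -
  have "f \<in> borel_measurable (lborel \<Otimes>\<^sub>M lborel)"
    using assms unfolding lborel_prod by simp
  then show ?thesis
    unfolding lborel_prod[symmetric] by (rule lborel.nn_integral_fst[symmetric])
qed

text \<open>In iterated form, only the integrals over \<open>x1\<close> and \<open>\<eta>2\<close>
  have to be exchanged.\<close>

lemma nn_integral_regroup:
  fixes f :: "(real \<times> real) \<times> (real^'n::finite) \<times> (real^'n) \<Rightarrow> ennreal"
  assumes [measurable]: "f \<in> borel_measurable borel"
  shows "(\<integral>\<^sup>+p. f (regroup p) \<partial>lborel) = (\<integral>\<^sup>+q. f q \<partial>lborel)"
proof -
  have "(\<integral>\<^sup>+p. f (regroup p) \<partial>lborel)
      = (\<integral>\<^sup>+\<eta>1. \<integral>\<^sup>+x1. \<integral>\<^sup>+\<eta>2. \<integral>\<^sup>+x2. f ((\<eta>1, \<eta>2), (x1, x2)) \<partial>lborel \<partial>lborel \<partial>lborel \<partial>lborel)"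
    by (simp add: nn_integral_lborel_pair)
  also have "\<dots> = (\<integral>\<^sup>+\<eta>1. \<integral>\<^sup>+\<eta>2. \<integral>\<^sup>+x1. \<integral>\<^sup>+x2. f ((\<eta>1, \<eta>2), (x1, x2)) \<partial>lborel \<partial>lborel \<partial>lborel \<partial>lborel)"
    by (intro nn_integral_cong lborel_pair.Fubini') measurable
  also have "\<dots> = (\<integral>\<^sup>+q. f q \<partial>lborel)"
    by (simp add: nn_integral_lborel_pair)
  finally show ?thesis .
qed

lemma distr_regroup: "distr lborel borel regroup = lborel"
proof (rule measure_eqI)
  fix S :: "((real \<times> real) \<times> (real^'a) \<times> (real^'a)) set"
  assume "S \<in> sets (distr lborel borel regroup)"
  then have [measurable]: "S \<in> sets borel" by simp
  have "emeasure (distr lborel borel regroup) S = (\<integral>\<^sup>+q. indicator S q \<partial>distr lborel borel regroup)"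
    by simp
  also have "\<dots> = (\<integral>\<^sup>+p. indicator S (regroup p) \<partial>lborel)"
    by (rule nn_integral_distr) measurable
  also have "\<dots> = emeasure lborel S"
    by (subst nn_integral_regroup) simp_all
  finally show "emeasure (distr lborel borel regroup) S = emeasure lborel S" .
qed simp

lemma distr_ungroup: "distr lborel borel ungroup = lborel"
proof -
  have "distr lborel borel ungroup = distr (distr lborel borel regroup) borel ungroup"
    by (simp only: distr_regroup)
  also have "\<dots> = lborel"
    by (simp add: distr_distr comp_def distr_id2)
  finally show ?thesis .
qed

text \<open>Applying \<open>AE_distrD\<close> to the map and to its inverse gives the equivalence
  for arbitrary \<open>Q\<close>.\<close>

lemma AE_regroup: "(AE p in lborel. Q (regroup p)) \<longleftrightarrow> (AE q in lborel. Q q)"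
proof
  assume "AE p in lborel. Q (regroup p)"
  then have "AE p in distr lborel borel ungroup. Q (regroup p)"
    unfolding distr_ungroup .
  from AE_distrD[OF _ this] show "AE q in lborel. Q q"
    by simp
next
  assume "AE q in lborel. Q q"
  then have "AE q in distr lborel borel regroup. Q q"
    unfolding distr_regroup .
  from AE_distrD[OF _ this] show "AE p in lborel. Q (regroup p)"
    by simp
qed

text \<open>Bridges the closed time square of \<open>solves\<close> and the half-open
  \<open>time_domain\<close>, which differ only where one of the times is 0.\<close>

lemma AE_times_nonzero:
  "AE p in lborel. case p of (\<eta>1, x1 :: real^'n::finite, \<eta>2, x2 :: real^'n) \<Rightarrow> \<eta>1 \<noteq> (0::real) \<and> \<eta>2 \<noteq> (0::real)"
proof -
  have nz: "AE x in lborel. x \<noteq> (0::real)"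
    by (rule AE_lborel_singleton)
  have "AE p in lborel. fst (p :: real \<times> (real^'n) \<times> real \<times> (real^'n)) \<noteq> 0"
    using nz by (intro AE_lborel_pairI) auto
  moreover have "AE p in lborel. fst (snd (snd (p :: real \<times> (real^'n) \<times> real \<times> (real^'n)))) \<noteq> 0"
  proof -
    have "AE p in lborel. fst (p :: real \<times> (real^'n)) \<noteq> 0"
      using nz by (intro AE_lborel_pairI) auto
    then have "AE p in lborel. fst (snd (p :: (real^'n) \<times> real \<times> (real^'n))) \<noteq> 0"
      by (intro AE_lborel_pairI) auto
    then show ?thesis
      by (intro AE_lborel_pairI) auto
  qed
  ultimately show ?thesis
    by eventually_elim auto
qed

text \<open>Time 0, where the weight may vanish, is left out.\<close>
definition time_domain :: "real \<Rightarrow> (real \<times> real) set" where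
  "time_domain T = {0<..T} \<times> {0<..T}"

text \<open>Extension by zero, since \<open>inB\<close> and the hypotheses on \<open>K\<close> say
  nothing about negative times, while the convolution needs a function measurable on the whole
  space.\<close>

definition restr :: "real \<Rightarrow> 'n::finite field2 \<Rightarrow> (real \<times> real) \<times> (real^'n) \<times> (real^'n) \<Rightarrow> complex" where
  "restr T \<psi> = (\<lambda>((\<eta>1, \<eta>2), (x1, x2)). if \<eta>1 \<in> {0<..T} \<and> \<eta>2 \<in> {0<..T} then \<psi> \<eta>1 x1 \<eta>2 x2 else 0)"

lemma time_domain_measurable [measurable]: "time_domain T \<in> sets borel"
  unfolding time_domain_def by (intro borel_Times) auto

lemma inB_imp_restr:
  fixes W :: "'n::finite field2"
  assumes "inB T W"
  shows "restr T W \<in> borel_measurable borel" and "bounded_slices (time_domain T) (restr T W)"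
proof -
  let ?g = "\<lambda>(\<eta>1, x1, \<eta>2, x2). if \<eta>1 \<in> {0..T} \<and> \<eta>2 \<in> {0..T} then W \<eta>1 x1 \<eta>2 x2 else 0"
  have [measurable]: "?g \<in> borel_measurable borel"
    using assms by (simp add: inB_def)
  have "restr T W = (\<lambda>q. if fst q \<in> time_domain T then ?g (ungroup q) else 0)"
    by (auto simp: restr_def time_domain_def fun_eq_iff)
  then show "restr T W \<in> borel_measurable borel"
    by simp
  from assms obtain C :: real where C: "AE \<eta>\<eta> in (lborel :: (real \<times> real) measure).
        fst \<eta>\<eta> \<in> {0..T} \<and> snd \<eta>\<eta> \<in> {0..T} \<longrightarrow>
          integrable lborel (\<lambda>(x1, x2). (cmod (W (fst \<eta>\<eta>) x1 (snd \<eta>\<eta>) x2))\<^sup>2) \<and>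
          (\<integral>(x1, x2). (cmod (W (fst \<eta>\<eta>) x1 (snd \<eta>\<eta>) x2))\<^sup>2 \<partial>lborel) \<le> C"
    by (auto simp: inB_def)
  show "bounded_slices (time_domain T) (restr T W)"
    unfolding bounded_slices_def
  proof (intro exI[of _ C])
    show "AE t in lborel. t \<in> time_domain T \<longrightarrow>
        (\<integral>\<^sup>+x. ennreal ((cmod (restr T W (t, x)))\<^sup>2) \<partial>lborel) \<le> ennreal C"
      using C
    proof eventually_elim
      case (elim t)
      obtain \<eta>1 \<eta>2 where t: "t = (\<eta>1, \<eta>2)" by (cases t)
      show ?case
      proof
        assume "t \<in> time_domain T"
        then have *: "\<eta>1 \<in> {0<..T}" "\<eta>2 \<in> {0<..T}"
          by (auto simp: t time_domain_def)
        let ?h = "\<lambda>(x1, x2). (cmod (W \<eta>1 x1 \<eta>2 x2))\<^sup>2"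
        have h: "integrable lborel ?h" "(\<integral>x. ?h x \<partial>lborel) \<le> C"
          using elim * by (auto simp: t)
        have "(\<integral>\<^sup>+x. ennreal ((cmod (restr T W (t, x)))\<^sup>2) \<partial>lborel) = (\<integral>\<^sup>+x. ennreal (?h x) \<partial>lborel)"
          using * by (intro nn_integral_cong) (auto simp: t restr_def)
        also have "\<dots> = ennreal (\<integral>x. ?h x \<partial>lborel)"
          using h(1) by (rule nn_integral_eq_integral) auto
        finally show "(\<integral>\<^sup>+x. ennreal ((cmod (restr T W (t, x)))\<^sup>2) \<partial>lborel) \<le> ennreal C"
          using h(2) by (simp add: ennreal_leI)
      qed
    qed
  qed
qed

lemma inB_of_bounded_slices:
  fixes \<xi> :: "(real \<times> real) \<times> (real^'n::finite) \<times> (real^'n) \<Rightarrow> complex"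
  assumes [measurable]: "\<xi> \<in> borel_measurable borel" and b: "bounded_slices (time_domain T) \<xi>"
  shows "inB T (\<lambda>\<eta>1 x1 \<eta>2 x2. if 0 < \<eta>1 \<and> 0 < \<eta>2 then \<xi> ((\<eta>1, \<eta>2), (x1, x2)) else 0)"
    (is "inB T ?W")
proof -
  have "(\<lambda>(\<eta>1, x1, \<eta>2, x2). if \<eta>1 \<in> {0..T} \<and> \<eta>2 \<in> {0..T} then ?W \<eta>1 x1 \<eta>2 x2 else 0)
      = (\<lambda>p. if fst (regroup p) \<in> time_domain T then \<xi> (regroup p) else 0)"
    by (auto simp: fun_eq_iff time_domain_def)
  also have "\<dots> \<in> borel_measurable lborel"
    by simp
  finally have 1: "(\<lambda>(\<eta>1, x1, \<eta>2, x2). if \<eta>1 \<in> {0..T} \<and> \<eta>2 \<in> {0..T} then ?W \<eta>1 x1 \<eta>2 x2 else 0)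
      \<in> borel_measurable lborel" .
  obtain C :: real where C: "AE t in lborel. t \<in> time_domain T \<longrightarrow>
     (\<integral>\<^sup>+x. ennreal ((cmod (\<xi> (t, x)))\<^sup>2) \<partial>lborel) \<le> ennreal C"
    using b by (auto simp: bounded_slices_def)
  \<comment> \<open>The maximum is taken because the real number behind \<open>ennreal C\<close> may
    be negative, whereas an integral of squares is not.\<close>
  have "AE \<eta>\<eta> in (lborel :: (real \<times> real) measure).
        fst \<eta>\<eta> \<in> {0..T} \<and> snd \<eta>\<eta> \<in> {0..T} \<longrightarrow>
          integrable lborel (\<lambda>(x1, x2). (cmod (?W (fst \<eta>\<eta>) x1 (snd \<eta>\<eta>) x2))\<^sup>2) \<and>
          (\<integral>(x1, x2). (cmod (?W (fst \<eta>\<eta>) x1 (snd \<eta>\<eta>) x2))\<^sup>2 \<partial>lborel) \<le> max 0 C"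
    using C
  proof eventually_elim
    case (elim t)
    obtain \<eta>1 \<eta>2 where t: "t = (\<eta>1, \<eta>2)" by (cases t)
    show ?case
    proof (cases "0 < \<eta>1 \<and> 0 < \<eta>2")
      case False
      then have "(\<lambda>(x1, x2). (cmod (?W \<eta>1 x1 \<eta>2 x2))\<^sup>2) = (\<lambda>_. 0)"
        by (auto simp: fun_eq_iff)
      then show ?thesis
        unfolding t fst_conv snd_conv by simp
    next
      case True
      then have eq: "(\<lambda>(x1, x2). (cmod (?W \<eta>1 x1 \<eta>2 x2))\<^sup>2) = (\<lambda>x. (cmod (\<xi> (t, x)))\<^sup>2)"
        by (auto simp: fun_eq_iff t)
      show ?thesis
      proof
        assume "fst t \<in> {0..T} \<and> snd t \<in> {0..T}"
        then have le: "(\<integral>\<^sup>+x. ennreal ((cmod (\<xi> (t, x)))\<^sup>2) \<partial>lborel) \<le> ennreal C"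
          using elim True by (auto simp: time_domain_def t)
        have int: "integrable lborel (\<lambda>x. (cmod (\<xi> (t, x)))\<^sup>2)"
          using le by (intro integrableI_bounded) (auto intro: le_less_trans)
        then have "ennreal (\<integral>x. (cmod (\<xi> (t, x)))\<^sup>2 \<partial>lborel) \<le> ennreal C"
          using le by (subst (asm) nn_integral_eq_integral) auto
        then have "(\<integral>x. (cmod (\<xi> (t, x)))\<^sup>2 \<partial>lborel) \<le> max 0 C"
          by (auto simp: ennreal_le_iff2)
        with int show "integrable lborel (\<lambda>(x1, x2). (cmod (?W (fst t) x1 (snd t) x2))\<^sup>2) \<and>
          (\<integral>(x1, x2). (cmod (?W (fst t) x1 (snd t) x2))\<^sup>2 \<partial>lborel) \<le> max 0 C"
          using eq unfolding t fst_conv snd_conv by simp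
      qed
    qed
  qed
  with 1 show ?thesis
    unfolding inB_def by blast
qed

text \<open>The exponents come from \<open>a\<^sup>2 = a\<^bsup>(5 - d) / 2\<^esup> \<cdot> a\<^bsup>(d - 1) / 2\<^esup>\<close>: the second factor is absorbed by the
  weighted unknown.\<close>
definition interaction ::
    "real \<Rightarrow> (real \<Rightarrow> real) \<Rightarrow> 'n::finite field2 \<Rightarrow> (real \<times> real) \<times> (real^'n) \<times> (real^'n) \<Rightarrow> complex" where
  "interaction T a K = restr T (\<lambda>\<eta>1 x1 \<eta>2 x2.
     complex_of_real (sqrt (a \<eta>1 ^ (5 - CARD('n))) * sqrt (a \<eta>2 ^ (5 - CARD('n)))) * K \<eta>1 x1 \<eta>2 x2)"

lemma interaction_measurable:
  fixes K :: "'n::finite field2"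
  assumes a_cont: "continuous_on {0..} a"
    and K_meas: "(\<lambda>(\<eta>1, x1, \<eta>2, x2). if \<eta>1 \<ge> 0 \<and> \<eta>2 \<ge> 0 then K \<eta>1 x1 \<eta>2 x2 else 0)
                   \<in> borel_measurable lborel"
  shows "interaction T a K \<in> borel_measurable borel"
proof -
  let ?g = "\<lambda>(\<eta>1, x1, \<eta>2, x2). if \<eta>1 \<ge> 0 \<and> \<eta>2 \<ge> 0 then K \<eta>1 x1 \<eta>2 x2 else 0"
  have [measurable]: "?g \<in> borel_measurable borel"
    using K_meas by simp
  \<comment> \<open>Nothing is known about \<open>a\<close> on negative times, so measurability is
    obtained for its extension by zero.\<close>
  define b where "b \<eta> = (if \<eta> \<in> {0..} then a \<eta> else 0)" for \<eta>
  have [measurable]: "b \<in> borel_measurable borel"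
    unfolding b_def by (intro borel_measurable_continuous_on_if a_cont) auto
  have "interaction T a K = (\<lambda>q. if fst q \<in> time_domain T then
      complex_of_real (sqrt (b (fst (fst q)) ^ (5 - CARD('n))) * sqrt (b (snd (fst q)) ^ (5 - CARD('n)))) * ?g (ungroup q) else 0)"
    by (auto simp: interaction_def restr_def time_domain_def fun_eq_iff b_def)
  then show ?thesis
    by simp
qed

text \<open>Once the weight is absorbed, a nonnegative power of \<open>a\<close> remains. It is
  bounded on the compact interval up to and including time 0, where \<open>1 / a\<close> would blow
  up.\<close>

lemma interaction_bounded:
  fixes K :: "'n::finite field2"
  assumes a_cont: "continuous_on {0..} a"
    and K_bdd: "\<exists>M. \<forall>\<eta>1 \<ge> 0. \<forall>\<eta>2 \<ge> 0. \<forall>x1 x2. cmod (K \<eta>1 x1 \<eta>2 x2) \<le> M"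
  shows "\<exists>B. \<forall>q. cmod (interaction T a K q) \<le> B"
proof -
  let ?b = "\<lambda>\<eta>. sqrt (a \<eta> ^ (5 - CARD('n)))"
  have "continuous_on {0..T} ?b"
    by (intro continuous_intros continuous_on_subset[OF a_cont]) auto
  then have "bounded (?b ` {0..T})"
    by (intro compact_imp_bounded compact_continuous_image) auto
  then obtain N where N: "\<And>\<eta>. \<eta> \<in> {0..T} \<Longrightarrow> \<bar>?b \<eta>\<bar> \<le> N"
    unfolding bounded_iff by (metis image_eqI real_norm_def)
  obtain M where M: "\<And>\<eta>1 \<eta>2 x1 x2. 0 \<le> \<eta>1 \<Longrightarrow> 0 \<le> \<eta>2 \<Longrightarrow> cmod (K \<eta>1 x1 \<eta>2 x2) \<le> M"
    using K_bdd by blast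
  have M0: "0 \<le> M"
    using M[of 0 0] norm_ge_zero order_trans by (meson order_refl)
  have "cmod (interaction T a K ((\<eta>1, \<eta>2), (x1, x2))) \<le> \<bar>N\<bar> * \<bar>N\<bar> * M" for \<eta>1 \<eta>2 x1 x2
  proof (cases "\<eta>1 \<in> {0<..T} \<and> \<eta>2 \<in> {0<..T}")
    case True
    then have "\<bar>?b \<eta>1\<bar> \<le> \<bar>N\<bar>" "\<bar>?b \<eta>2\<bar> \<le> \<bar>N\<bar>" "cmod (K \<eta>1 x1 \<eta>2 x2) \<le> M"
      using N[of \<eta>1] N[of \<eta>2] M[of \<eta>1 \<eta>2] by auto
    then have "\<bar>?b \<eta>1\<bar> * \<bar>?b \<eta>2\<bar> * cmod (K \<eta>1 x1 \<eta>2 x2) \<le> \<bar>N\<bar> * \<bar>N\<bar> * M"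
      by (intro mult_mono) auto
    then show ?thesis
      using True by (simp add: interaction_def restr_def norm_mult abs_mult)
  qed (auto simp: interaction_def restr_def M0)
  then show ?thesis
    by (intro exI[of _ "\<bar>N\<bar> * \<bar>N\<bar> * M"]) (simp add: split_paired_all)
qed

lemma restr_outside: "fst q \<notin> time_domain T \<Longrightarrow> restr T W q = 0"
  by (auto simp: restr_def time_domain_def split: prod.splits)

text \<open>Multiplying the integral equation by the weights turns it into a convolution equation for the
  weighted unknown; \<open>\<nu>\<close> is the retarded Green's function of the two particles, cut off at time \<open>T\<close>.\<close>
lemma well_posed_of_convolution:
  fixes T :: real and a :: "real \<Rightarrow> real" and K :: "'n::finite field2"
    and c \<gamma> :: complex and \<psi>free :: "'n field2"
    and \<nu> :: "((real \<times> real) \<times> (real^'n) \<times> (real^'n)) measure"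
  assumes a_cont: "continuous_on {0..} a"
    and a_pos: "\<And>\<eta>. \<eta> > 0 \<Longrightarrow> a \<eta> > 0"
    and K_bdd: "\<exists>M. \<forall>\<eta>1 \<ge> 0. \<forall>\<eta>2 \<ge> 0. \<forall>x1 x2. cmod (K \<eta>1 x1 \<eta>2 x2) \<le> M"
    and K_meas: "(\<lambda>(\<eta>1, x1, \<eta>2, x2). if \<eta>1 \<ge> 0 \<and> \<eta>2 \<ge> 0 then K \<eta>1 x1 \<eta>2 x2 else 0)
                   \<in> borel_measurable lborel"
    and free: "inB T (weighted CARD('n) a \<psi>free)"
    and \<nu>: "finite_measure \<nu>" "sets \<nu> = sets borel" "AE u in \<nu>. 0 < fst (fst u) + snd (fst u)"
    and conv: "\<And>\<psi> \<eta>1 x1 \<eta>2 x2. restr T (weighted CARD('n) a \<psi>) \<in> borel_measurable borel \<Longrightarrow>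
        \<eta>1 \<in> {0<..T} \<Longrightarrow> \<eta>2 \<in> {0<..T} \<Longrightarrow>
        complex_of_real (wgt CARD('n) a \<eta>1 * wgt CARD('n) a \<eta>2) * intop a K c \<psi> \<eta>1 x1 \<eta>2 x2
        = (\<integral>u. \<gamma> * interaction T a K (((\<eta>1, \<eta>2), (x1, x2)) - u)
             * restr T (weighted CARD('n) a \<psi>) (((\<eta>1, \<eta>2), (x1, x2)) - u) \<partial>\<nu>)"
  shows "\<exists>\<psi>. inB T (weighted CARD('n) a \<psi>) \<and> solves T a K c \<psi>free \<psi> \<and>
           (\<forall>\<phi>. inB T (weighted CARD('n) a \<phi>) \<and> solves T a K c \<psi>free \<phi> \<longrightarrow>
              (AE p in lborel. case p of (\<eta>1, x1, \<eta>2, x2) \<Rightarrow>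
                 \<eta>1 \<in> {0..T} \<and> \<eta>2 \<in> {0..T} \<longrightarrow> \<phi> \<eta>1 x1 \<eta>2 x2 = \<psi> \<eta>1 x1 \<eta>2 x2))"
proof -
  let ?d = "CARD('n)"
  let ?k = "\<lambda>q. \<gamma> * interaction T a K q"
  let ?R = "\<lambda>\<psi>. restr T (weighted ?d a \<psi>)"
  have w: "0 < wgt ?d a \<eta>" if "0 < \<eta>" for \<eta>
    using a_pos[OF that] by (simp add: wgt_def)
  then have w0: "0 < \<eta> \<Longrightarrow> wgt ?d a \<eta> \<noteq> 0" for \<eta>
    by (metis less_irrefl)
  obtain B where B: "\<And>q. cmod (interaction T a K q) \<le> B"
    using interaction_bounded[OF a_cont K_bdd] by blast
  note interaction_measurable[OF a_cont K_meas, measurable]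
  \<comment> \<open>The direction (1, 1) adds the two times, whence the upper bound
    \<open>2 * T\<close>.\<close>
  interpret retarded_convolution \<nu> "time_domain T" "(1, 1)" "2 * T" ?k "cmod \<gamma> * B"
  proof (rule retarded_convolution.intro)
    show "cmod (?k q) \<le> cmod \<gamma> * B" for q
      by (simp add: norm_mult mult_left_mono B)
    show "?k q = 0" if "fst q \<notin> time_domain T" for q
      using that by (simp add: interaction_def restr_outside)
    show "AE u in \<nu>. 0 < (1, 1) \<bullet> fst u"
      using \<nu>(3) by eventually_elim (simp add: inner_prod_def)
    show "0 \<le> (1, 1) \<bullet> t \<and> (1, 1) \<bullet> t \<le> 2 * T" if "t \<in> time_domain T" for t
      using that by (auto simp: inner_prod_def time_domain_def)
  qed (simp_all add: \<nu>)
  have solves_iff: "solves T a K c \<psi>free \<psi> \<longleftrightarrow>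
      (AE q in lborel. fst q \<in> time_domain T \<longrightarrow> ?R \<psi> q = ?R \<psi>free q + volterra (?R \<psi>) q)"
    if \<psi>: "?R \<psi> \<in> borel_measurable borel" for \<psi>
  proof -
    \<comment> \<open>At positive times the weights are nonzero, so multiplying the equation by them
      is reversible.\<close>
    have pointwise: "(\<eta>1 \<in> {0..T} \<and> \<eta>2 \<in> {0..T} \<longrightarrow>
          \<psi> \<eta>1 x1 \<eta>2 x2 = \<psi>free \<eta>1 x1 \<eta>2 x2 + intop a K c \<psi> \<eta>1 x1 \<eta>2 x2) \<longleftrightarrow>
        ((\<eta>1, \<eta>2) \<in> time_domain T \<longrightarrow> ?R \<psi> ((\<eta>1, \<eta>2), (x1, x2))
            = ?R \<psi>free ((\<eta>1, \<eta>2), (x1, x2)) + volterra (?R \<psi>) ((\<eta>1, \<eta>2), (x1, x2)))"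
      if nz: "\<eta>1 \<noteq> 0" "\<eta>2 \<noteq> 0" for \<eta>1 x1 \<eta>2 x2
    proof (cases "\<eta>1 \<in> {0<..T} \<and> \<eta>2 \<in> {0<..T}")
      case True
      then have volterra: "volterra (?R \<psi>) ((\<eta>1, \<eta>2), (x1, x2))
          = complex_of_real (wgt ?d a \<eta>1 * wgt ?d a \<eta>2) * intop a K c \<psi> \<eta>1 x1 \<eta>2 x2"
        using conv[OF \<psi>, of \<eta>1 \<eta>2 x1 x2] by (simp add: volterra_def)
      have "wgt ?d a \<eta>1 * wgt ?d a \<eta>2 \<noteq> 0"
        using w[of \<eta>1] w[of \<eta>2] True by auto
      moreover have "?R \<phi> ((\<eta>1, \<eta>2), (x1, x2))
          = complex_of_real (wgt ?d a \<eta>1 * wgt ?d a \<eta>2) * \<phi> \<eta>1 x1 \<eta>2 x2" for \<phi>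
        using True by (simp add: restr_def weighted_def)
      ultimately show ?thesis
        using True unfolding volterra by (auto simp: time_domain_def simp flip: distrib_left of_real_mult)
    next
      case False
      then show ?thesis
        using nz by (auto simp: time_domain_def)
    qed
    have "solves T a K c \<psi>free \<psi> \<longleftrightarrow> (AE p in lborel. fst (regroup p) \<in> time_domain T \<longrightarrow>
        ?R \<psi> (regroup p) = ?R \<psi>free (regroup p) + volterra (?R \<psi>) (regroup p))"
      unfolding solves_def
    proof (rule eventually_subst)
      show "AE p in lborel. (case p of (\<eta>1, x1, \<eta>2, x2) \<Rightarrow> \<eta>1 \<in> {0..T} \<and> \<eta>2 \<in> {0..T} \<longrightarrow>
            \<psi> \<eta>1 x1 \<eta>2 x2 = \<psi>free \<eta>1 x1 \<eta>2 x2 + intop a K c \<psi> \<eta>1 x1 \<eta>2 x2)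
          \<longleftrightarrow> (fst (regroup p) \<in> time_domain T \<longrightarrow>
            ?R \<psi> (regroup p) = ?R \<psi>free (regroup p) + volterra (?R \<psi>) (regroup p))"
        using AE_times_nonzero
      proof eventually_elim
        case (elim p)
        obtain \<eta>1 x1 \<eta>2 x2 where p: "p = (\<eta>1, x1, \<eta>2, x2)" by (cases p)
        show ?case
          using elim pointwise[of \<eta>1 \<eta>2 x1 x2] unfolding p prod.case regroup_simps fst_conv by blast
      qed
    qed
    then show ?thesis
      by (simp add: AE_regroup[where Q = "\<lambda>q. fst q \<in> time_domain T \<longrightarrow> ?R \<psi> q = ?R \<psi>free q + volterra (?R \<psi>) q"])
  qed
  obtain \<xi> where \<xi>: "\<xi> \<in> borel_measurable borel" "bounded_slices (time_domain T) \<xi>"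
    "AE p in lborel. fst p \<in> time_domain T \<longrightarrow> \<xi> p = ?R \<psi>free p + volterra \<xi> p"
    "\<And>\<zeta>. \<zeta> \<in> borel_measurable borel \<Longrightarrow> bounded_slices (time_domain T) \<zeta> \<Longrightarrow>
       AE p in lborel. fst p \<in> time_domain T \<longrightarrow> \<zeta> p = ?R \<psi>free p + volterra \<zeta> p \<Longrightarrow>
       AE p in lborel. fst p \<in> time_domain T \<longrightarrow> \<zeta> p = \<xi> p"
    using unique_solution[OF inB_imp_restr[OF free]] by blast
  \<comment> \<open>Undoes the weighting. At time 0, where the weight may vanish, the value is
    arbitrary and 0 is chosen.\<close>
  define \<psi> :: "'n field2" where
    "\<psi> = (\<lambda>\<eta>1 x1 \<eta>2 x2. if 0 < \<eta>1 \<and> 0 < \<eta>2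
       then \<xi> ((\<eta>1, \<eta>2), (x1, x2)) / complex_of_real (wgt ?d a \<eta>1 * wgt ?d a \<eta>2) else 0)"
  have W: "weighted ?d a \<psi> = (\<lambda>\<eta>1 x1 \<eta>2 x2. if 0 < \<eta>1 \<and> 0 < \<eta>2 then \<xi> ((\<eta>1, \<eta>2), (x1, x2)) else 0)"
    by (intro ext) (auto simp: weighted_def \<psi>_def w0)
  then have inB: "inB T (weighted ?d a \<psi>)"
    using inB_of_bounded_slices[OF \<xi>(1,2)] by simp
  have R: "?R \<psi> q = (if fst q \<in> time_domain T then \<xi> q else 0)" for q
    unfolding W by (auto simp: restr_def time_domain_def split: prod.splits)
  have "volterra (?R \<psi>) = volterra \<xi>"
    by (rule volterra_cong) (simp add: R)
  then have "AE q in lborel. fst q \<in> time_domain T \<longrightarrow> ?R \<psi> q = ?R \<psi>free q + volterra (?R \<psi>) q"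
    using \<xi>(3) by (simp add: R)
  then have sol: "solves T a K c \<psi>free \<psi>"
    using solves_iff[OF inB_imp_restr(1)[OF inB]] by blast
  have uniq: "AE p in lborel. case p of (\<eta>1, x1, \<eta>2, x2) \<Rightarrow>
                 \<eta>1 \<in> {0..T} \<and> \<eta>2 \<in> {0..T} \<longrightarrow> \<phi> \<eta>1 x1 \<eta>2 x2 = \<psi> \<eta>1 x1 \<eta>2 x2"
    if \<phi>: "inB T (weighted ?d a \<phi>)" "solves T a K c \<psi>free \<phi>" for \<phi>
  proof -
    have "AE q in lborel. fst q \<in> time_domain T \<longrightarrow> ?R \<phi> q = \<xi> q"
      using \<phi>(2) solves_iff[OF inB_imp_restr(1)[OF \<phi>(1)]] by (intro \<xi>(4) inB_imp_restr \<phi>(1)) blast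
    then have "AE p in lborel. fst (regroup p) \<in> time_domain T \<longrightarrow> ?R \<phi> (regroup p) = \<xi> (regroup p)"
      by (rule AE_regroup[THEN iffD2])
    then show ?thesis
      using AE_times_nonzero
    proof eventually_elim
      case (elim p)
      obtain \<eta>1 x1 \<eta>2 x2 where p: "p = (\<eta>1, x1, \<eta>2, x2)" by (cases p)
      show ?case
      proof (cases "\<eta>1 \<in> {0<..T} \<and> \<eta>2 \<in> {0<..T}")
        case True
        then have "complex_of_real (wgt ?d a \<eta>1 * wgt ?d a \<eta>2) * \<phi> \<eta>1 x1 \<eta>2 x2 = \<xi> ((\<eta>1, \<eta>2), (x1, x2))"
          using elim by (simp add: p restr_def weighted_def time_domain_def)
        then show ?thesis
          using True w[of \<eta>1] w[of \<eta>2] by (auto simp: p \<psi>_def field_simps)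
      qed (use elim in \<open>auto simp: p\<close>)
    qed
  qed
  show ?thesis
    using inB sol uniq by blast
qed

section \<open>Retarded Green functions\<close>

text \<open>Integrate \<open>1 / \<bar>y\<bar> = 1 / T + \<integral> dr / r\<^sup>2\<close> (over \<open>\<bar>y\<bar> \<le> r \<le> T\<close>) over the ball and exchange the
  integrals.\<close>
lemma nn_integral_inverse_norm_finite:
  assumes dim: "2 \<le> DIM('a::euclidean_space)" and T: "0 < T"
  shows "(\<integral>\<^sup>+y. ennreal (if norm (y::'a) \<le> T then 1 / norm y else 0) \<partial>lborel) < \<infinity>"
proof -
  let ?n = "DIM('a)"
  define V where "V = unit_ball_vol (real ?n)"
  have V: "0 \<le> V"
    by (simp add: V_def)
  have cball: "emeasure lborel (cball (0::'a) r) = ennreal (V * r ^ ?n)" if "0 \<le> r" for r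
    using emeasure_cball[OF that, of "0::'a"] by (simp add: V_def)
  define h where "h r y = ennreal (if norm y \<le> r \<and> r \<le> T \<and> 0 < r then 1 / r\<^sup>2 else 0)" for r and y :: 'a
  have [measurable]: "case_prod h \<in> borel_measurable (borel \<Otimes>\<^sub>M borel)"
    unfolding h_def by measurable
  have "ennreal (if norm y \<le> T then 1 / norm y else 0) \<le> ennreal (1 / T) * indicator (cball 0 T) y + (\<integral>\<^sup>+r. h r y \<partial>lborel)" for y :: 'a
  \<comment> \<open>At the origin the left side is 0, by the convention for division by
    zero.\<close>
  proof (cases "y = 0 \<or> norm y > T")
    case False
    then have y: "0 < norm y" "norm y \<le> T" by auto
    have "(\<integral>\<^sup>+r. h r y \<partial>lborel) = (\<integral>\<^sup>+r. ennreal (1 / r\<^sup>2) * indicator {norm y..T} r \<partial>lborel)"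
    proof (intro nn_integral_cong)
      fix r
      have "0 < r" if "norm y \<le> r"
        using y(1) that by linarith
      then show "h r y = ennreal (1 / r\<^sup>2) * indicator {norm y..T} r"
        by (auto simp: h_def)
    qed
    also have "\<dots> = ennreal (- 1 / T - - 1 / norm y)"
      using y by (intro nn_integral_FTC_Icc)
        (auto intro!: derivative_eq_intros simp: power2_eq_square)
    finally have "(\<integral>\<^sup>+r. h r y \<partial>lborel) = ennreal (1 / norm y - 1 / T)"
      by simp
    moreover have "1 / T \<le> 1 / norm y"
      using y by (intro frac_le) auto
    then have "ennreal (1 / norm y) = ennreal (1 / T) + ennreal (1 / norm y - 1 / T)"
      using T by (subst ennreal_plus[symmetric]) auto
    ultimately show ?thesis
      using y by simp
  qed auto
  then have "(\<integral>\<^sup>+y. ennreal (if norm (y::'a) \<le> T then 1 / norm y else 0) \<partial>lborel)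
      \<le> (\<integral>\<^sup>+y. ennreal (1 / T) * indicator (cball 0 T) y + (\<integral>\<^sup>+r. h r y \<partial>lborel) \<partial>lborel)"
    by (intro nn_integral_mono)
  also have "\<dots> = ennreal (1 / T) * emeasure lborel (cball (0::'a) T) + (\<integral>\<^sup>+y. \<integral>\<^sup>+r. h r y \<partial>lborel \<partial>lborel)"
  proof (subst nn_integral_add)
    show "(\<lambda>y. ennreal (1 / T) * indicator (cball (0::'a) T) y) \<in> borel_measurable lborel"
      by (intro borel_measurable_times_ennreal borel_measurable_indicator) auto
    show "(\<lambda>y. \<integral>\<^sup>+r. h r y \<partial>lborel) \<in> borel_measurable lborel"
      unfolding h_def by measurable
  qed (simp add: nn_integral_cmult_indicator)
  also have "(\<integral>\<^sup>+y. \<integral>\<^sup>+r. h r y \<partial>lborel \<partial>lborel) = (\<integral>\<^sup>+r. \<integral>\<^sup>+y. h r y \<partial>lborel \<partial>lborel)"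
    by (intro lborel_pair.Fubini') simp
  also have "\<dots> \<le> (\<integral>\<^sup>+r. ennreal (V * T ^ (?n - 2)) * indicator {0<..T} r \<partial>lborel)"
  proof (intro nn_integral_mono)
    fix r :: real
    show "(\<integral>\<^sup>+y. h r y \<partial>lborel) \<le> ennreal (V * T ^ (?n - 2)) * indicator {0<..T} r"
    proof (cases "0 < r \<and> r \<le> T")
      case True
      then have "(\<integral>\<^sup>+y. h r y \<partial>lborel) = (\<integral>\<^sup>+y. ennreal (1 / r\<^sup>2) * indicator (cball (0::'a) r) y \<partial>lborel)"
        by (intro nn_integral_cong) (auto simp: h_def indicator_def)
      also have "\<dots> = ennreal (1 / r\<^sup>2) * ennreal (V * r ^ ?n)"
        using True by (subst nn_integral_cmult_indicator) (auto simp: cball)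
      also have "\<dots> = ennreal (1 / r\<^sup>2 * (V * r ^ ?n))"
        using True V by (intro ennreal_mult[symmetric]) auto
      \<comment> \<open>The dimension enters here: from 2 on, the volume of the ball compensates the
        singularity and leaves a power of \<open>r\<close> bounded on (0, T].\<close>
      also have "1 / r\<^sup>2 * (V * r ^ ?n) = V * r ^ (?n - 2)"
        using True dim by (simp add: power_diff)
      also have "ennreal (V * r ^ (?n - 2)) \<le> ennreal (V * T ^ (?n - 2))"
        using True V by (intro ennreal_leI mult_left_mono power_mono) auto
      finally show ?thesis
        using True by simp
    qed (auto simp: h_def)
  qed
  also have "\<dots> = ennreal (V * T ^ (?n - 2)) * ennreal T"
    using T by (subst nn_integral_cmult_indicator) auto
  finally show ?thesis
    using T by (auto simp: cball ennreal_mult_less_top intro: le_less_trans)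
qed

lemma nn_integral_inverse_sqrt_finite:
  assumes T: "0 < T"
  shows "(\<integral>\<^sup>+s. ennreal (if 0 \<le> s \<and> s \<le> T then 1 / sqrt s else 0) \<partial>lborel) < \<infinity>"
proof -
  have "((\<lambda>s. s powr (- 1 / 2)) has_integral (T powr (- 1 / 2 + 1) / (- 1 / 2 + 1))) {0..T}"
    using T by (intro has_integral_powr_from_0) auto
  then have "((\<lambda>s. if s \<in> {0..T} then s powr (- 1 / 2) else 0) has_integral (T powr (- 1 / 2 + 1) / (- 1 / 2 + 1))) UNIV"
    by (simp only: has_integral_restrict_UNIV)
  moreover have "(\<lambda>s. if s \<in> {0..T} then s powr (- 1 / 2) else 0) = (\<lambda>s. if 0 \<le> s \<and> s \<le> T then 1 / sqrt s else 0)"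
    by (auto simp: fun_eq_iff powr_minus_divide powr_half_sqrt)
  ultimately have "integral\<^sup>N lborel (\<lambda>s. ennreal (if 0 \<le> s \<and> s \<le> T then 1 / sqrt s else 0))
      = ennreal (T powr (- 1 / 2 + 1) / (- 1 / 2 + 1))"
    by (intro nn_integral_has_integral_lborel) auto
  then show ?thesis
    by simp
qed

text \<open>Retarded Green functions of the wave equation up to their factors 1/2 and 1/(2 pi),
  whose squares appear in the prefactors of the equations. The cutoff at \<open>T\<close> gives
  finite mass and changes no integral, since times in [0, T] differ by at most
  \<open>T\<close>.\<close>

definition green1 :: "real \<Rightarrow> real \<Rightarrow> 'a::real_normed_vector \<Rightarrow> real" where
  "green1 T s y = (if 0 \<le> s \<and> s \<le> T \<and> norm y \<le> s then 1 else 0)"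

definition green2 :: "real \<Rightarrow> real \<Rightarrow> 'a::real_normed_vector \<Rightarrow> real" where
  "green2 T s y = (if 0 \<le> s \<and> s \<le> T \<and> norm y \<le> s then 1 / sqrt (s\<^sup>2 - (norm y)\<^sup>2) else 0)"

lemma nn_integral_green1_finite:
  "(\<integral>\<^sup>+p. ennreal (green1 T (fst p) (snd p :: 'a::euclidean_space)) \<partial>lborel) < \<infinity>"
proof -
  have "(\<integral>\<^sup>+p. ennreal (green1 T (fst p) (snd p :: 'a::euclidean_space)) \<partial>lborel)
      \<le> (\<integral>\<^sup>+p. indicator ({0..T} \<times> cball (0::'a) T) p \<partial>lborel)"
    by (intro nn_integral_mono) (auto simp: green1_def indicator_def)
  also have "\<dots> = emeasure lborel ({0..T} \<times> cball (0::'a) T)"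
    by (rule nn_integral_indicator) (simp add: borel_Times)
  also have "\<dots> < \<infinity>"
    by (intro emeasure_bounded_finite bounded_Times) auto
  finally show ?thesis .
qed

text \<open>Integrating over time first, with r the norm of \<open>y\<close>, avoids polar
  coordinates: (s + r)(s - r) is at least r(s - r), so the inner integral is at most
  \<open>I\<close> divided by the square root of r. As z is at most 1 + z squared, that inverse root
  is at most 1 + 1/r, whose integral over the ball is already known to be finite.\<close>

lemma nn_integral_green2_finite:
  assumes dim: "2 \<le> DIM('a::euclidean_space)" and T: "0 < T"
  shows "(\<integral>\<^sup>+p. ennreal (green2 T (fst p) (snd p :: 'a)) \<partial>lborel) < \<infinity>"
proof -
  define I where "I = (\<integral>\<^sup>+s. ennreal (if 0 \<le> s \<and> s \<le> T then 1 / sqrt s else 0) \<partial>lborel)"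
  have [measurable]: "(\<lambda>p. green2 T (fst p) (snd p :: 'a)) \<in> borel_measurable borel"
    unfolding green2_def by measurable
  have inner: "(\<integral>\<^sup>+s. ennreal (green2 T s y) \<partial>lborel)
      \<le> I * (indicator (cball 0 T) y + ennreal (if norm y \<le> T then 1 / norm y else 0))"
    if "y \<noteq> 0" for y :: 'a
  proof (cases "norm y \<le> T")
    case False
    then have "green2 T s y = 0" for s
      by (auto simp: green2_def)
    then show ?thesis by simp
  next
    case True
    define r where "r = norm y"
    have r: "0 < r" "r \<le> T"
      using that True by (auto simp: r_def)
    have "green2 T s y \<le> 1 / sqrt r * (if 0 \<le> s - r \<and> s - r \<le> T then 1 / sqrt (s - r) else 0)" for s
    proof (cases "r < s \<and> s \<le> T")
      case True
      have "r * (s - r) \<le> (s + r) * (s - r)"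
        using True r by (intro mult_right_mono) auto
      also have "\<dots> = s\<^sup>2 - r\<^sup>2"
        by (simp add: power2_eq_square algebra_simps)
      finally have "sqrt r * sqrt (s - r) \<le> sqrt (s\<^sup>2 - r\<^sup>2)"
        by (simp flip: real_sqrt_mult)
      moreover have "0 < sqrt r * sqrt (s - r)"
        using True r by auto
      ultimately have "1 / sqrt (s\<^sup>2 - r\<^sup>2) \<le> 1 / (sqrt r * sqrt (s - r))"
        by (intro frac_le) auto
      then show ?thesis
        using True r by (simp add: green2_def r_def[symmetric])
    next
      case False
      then show ?thesis
        using r by (auto simp: green2_def r_def[symmetric])
    qed
    then have "(\<integral>\<^sup>+s. ennreal (green2 T s y) \<partial>lborel)
        \<le> (\<integral>\<^sup>+s. ennreal (1 / sqrt r) * ennreal (if 0 \<le> s - r \<and> s - r \<le> T then 1 / sqrt (s - r) else 0) \<partial>lborel)"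
      using r by (intro nn_integral_mono) (auto simp: ennreal_mult[symmetric] intro!: ennreal_leI)
    also have "\<dots> = ennreal (1 / sqrt r) * I"
      unfolding I_def
      by (subst nn_integral_cmult, measurable) (subst nn_integral_lborel_translate[where c = r and f = "\<lambda>s. ennreal (if 0 \<le> s \<and> s \<le> T then 1 / sqrt s else 0)"], auto)
    also have "1 / sqrt r \<le> 1 + 1 / r"
    proof -
      have sq: "z \<le> 1 + z\<^sup>2" if "0 \<le> z" for z :: real
        using sum_squares_bound[of z 1] that by simp
      have "1 / sqrt r \<le> 1 + (1 / sqrt r)\<^sup>2"
        using sq[of "1 / sqrt r"] r by simp
      then show ?thesis
        using r by (simp add: power_divide)
    qed
    finally have "(\<integral>\<^sup>+s. ennreal (green2 T s y) \<partial>lborel) \<le> ennreal (1 + 1 / r) * I"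
      by (meson ennreal_leI mult_right_mono order_trans zero_le)
    then show ?thesis
      using r True by (simp add: r_def mult.commute)
  qed
  have "(\<integral>\<^sup>+p. ennreal (green2 T (fst p) (snd p :: 'a)) \<partial>lborel)
      = (\<integral>\<^sup>+s. \<integral>\<^sup>+y. ennreal (green2 T s (y::'a)) \<partial>lborel \<partial>lborel)"
    by (simp add: nn_integral_lborel_pair)
  also have "\<dots> = (\<integral>\<^sup>+y. \<integral>\<^sup>+s. ennreal (green2 T s (y::'a)) \<partial>lborel \<partial>lborel)"
    by (intro lborel_pair.Fubini') (simp add: green2_def)
  also have "\<dots> \<le> (\<integral>\<^sup>+y. I * (indicator (cball (0::'a) T) y + ennreal (if norm y \<le> T then 1 / norm y else 0)) \<partial>lborel)"
  proof (rule nn_integral_mono_AE)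
    show "AE y in lborel. (\<integral>\<^sup>+s. ennreal (green2 T s (y::'a)) \<partial>lborel)
        \<le> I * (indicator (cball 0 T) y + ennreal (if norm y \<le> T then 1 / norm y else 0))"
      using AE_lborel_singleton[of "0::'a"] by eventually_elim (rule inner)
  qed
  also have "\<dots> = I * (emeasure lborel (cball (0::'a) T) + (\<integral>\<^sup>+y. ennreal (if norm (y::'a) \<le> T then 1 / norm y else 0) \<partial>lborel))"
  proof -
    have ind: "(\<lambda>y. indicator (cball (0::'a) T) y :: ennreal) \<in> borel_measurable lborel"
      by (intro borel_measurable_indicator) auto
    have inv: "(\<lambda>y::'a. ennreal (if norm y \<le> T then 1 / norm y else 0)) \<in> borel_measurable lborel"
      by measurable
    show ?thesis
      by (subst nn_integral_cmult[OF borel_measurable_add[OF ind inv]], subst nn_integral_add[OF ind inv]) simp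
  qed
  also have "\<dots> < \<infinity>"
    using nn_integral_inverse_norm_finite[OF dim T] nn_integral_inverse_sqrt_finite[OF T]
      emeasure_bounded_finite[OF bounded_cball, of "0::'a" T]
    by (simp add: ennreal_mult_less_top I_def)
  finally show ?thesis .
qed

lemma weight_factorization:
  assumes "d \<in> {1, 2, 3}" and "0 \<le> a \<eta>"
  shows "(a \<eta>)\<^sup>2 = sqrt (a \<eta> ^ (5 - d)) * wgt d a \<eta>"
proof -
  have "sqrt (a \<eta> ^ (5 - d)) * wgt d a \<eta> = sqrt (((a \<eta>)\<^sup>2)\<^sup>2)"
    using assms(1) by (auto simp: wgt_def real_sqrt_mult[symmetric] power_add[symmetric] simp flip: power_mult power_Suc power_Suc2)
  then show ?thesis
    by (simp only: real_sqrt_abs) simp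
qed

text \<open>Valid on the closed square: when a time is 0, the left side vanishes by the cutoff and
  the right side because \<open>a 0 = 0\<close>. It can therefore be used inside an integral over a
  cone without discarding points.\<close>

lemma interaction_restr_weighted:
  fixes K \<psi> :: "'n::finite field2"
  assumes d: "CARD('n) \<in> {1, 2, 3}" and a0: "a 0 = 0" and a_pos: "\<And>\<eta>. \<eta> > 0 \<Longrightarrow> a \<eta> > 0"
    and "\<eta>1 \<in> {0..T}" "\<eta>2 \<in> {0..T}"
  shows "interaction T a K ((\<eta>1, \<eta>2), (x1, x2)) * restr T (weighted CARD('n) a \<psi>) ((\<eta>1, \<eta>2), (x1, x2))
     = complex_of_real ((a \<eta>1)\<^sup>2 * (a \<eta>2)\<^sup>2) * K \<eta>1 x1 \<eta>2 x2 * \<psi> \<eta>1 x1 \<eta>2 x2"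
proof (cases "\<eta>1 = 0 \<or> \<eta>2 = 0")
  case True
  then show ?thesis
    using a0 by (auto simp: restr_def)
next
  case False
  then have "\<eta>1 \<in> {0<..T}" "\<eta>2 \<in> {0<..T}"
    using assms by auto
  then show ?thesis
    using weight_factorization[OF d, of a \<eta>1] weight_factorization[OF d, of a \<eta>2] a_pos[of \<eta>1] a_pos[of \<eta>2]
    by (simp add: interaction_def restr_def weighted_def)
qed

section \<open>Dimensions 1 and 2: Green functions with a density\<close>

definition density_measure ::
    "(real \<Rightarrow> real^'n::finite \<Rightarrow> real) \<Rightarrow> ((real \<times> real) \<times> (real^'n) \<times> (real^'n)) measure" where
  "density_measure G = density lborel (\<lambda>u. ennreal (G (fst (fst u)) (fst (snd u)) * G (snd (fst u)) (snd (snd u))))"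

context
  fixes G :: "real \<Rightarrow> real^'n::finite \<Rightarrow> real" and T :: real
  assumes G_meas: "(\<lambda>p. G (fst p) (snd p)) \<in> borel_measurable borel"
    and G_nonneg: "\<And>s y. 0 \<le> G s y"
    and G_supp: "\<And>s y. s \<notin> {0..T} \<Longrightarrow> G s y = 0"
    and G_finite: "(\<integral>\<^sup>+p. ennreal (G (fst p) (snd p)) \<partial>lborel) < \<infinity>"
begin

lemma G_measurable:
  assumes [measurable]: "f \<in> borel_measurable M" "g \<in> borel_measurable M"
  shows "(\<lambda>x. G (f x) (g x)) \<in> borel_measurable M"
  using measurable_compose[OF _ G_meas, of "\<lambda>x. (f x, g x)" M] by simp

lemma finite_density_measure: "finite_measure (density_measure G)"
proof (rule finite_measureI)
  note G_measurable [measurable (raw)]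
  let ?I = "\<integral>\<^sup>+p. ennreal (G (fst p) (snd p)) \<partial>lborel"
  have I: "?I = (\<integral>\<^sup>+s. \<integral>\<^sup>+y. ennreal (G s y) \<partial>lborel \<partial>lborel)"
    by (simp add: nn_integral_lborel_pair)
  let ?f = "\<lambda>u. ennreal (G (fst (fst u)) (fst (snd u)) * G (snd (fst u)) (snd (snd u)))"
  have "emeasure (density_measure G) (space (density_measure G)) = (\<integral>\<^sup>+u. ?f u \<partial>lborel)"
    by (simp add: density_measure_def emeasure_density)
  also have "\<dots> = (\<integral>\<^sup>+p. ?f (regroup p) \<partial>lborel)"
    by (rule nn_integral_regroup[symmetric]) measurable
  also have "\<dots> = (\<integral>\<^sup>+s1. \<integral>\<^sup>+y1. \<integral>\<^sup>+s2. \<integral>\<^sup>+y2. ennreal (G s1 y1) * ennreal (G s2 y2) \<partial>lborel \<partial>lborel \<partial>lborel \<partial>lborel)"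
    by (simp add: nn_integral_lborel_pair ennreal_mult G_nonneg)
  also have "\<dots> = ?I * ?I"
    unfolding I by (simp add: nn_integral_cmult nn_integral_multc)
  also have "\<dots> < \<infinity>"
    using G_finite by (simp add: ennreal_mult_less_top)
  finally show "emeasure (density_measure G) (space (density_measure G)) \<noteq> \<infinity>"
    by simp
qed

text \<open>The support of \<open>G\<close> makes both time displacements nonnegative; discarding
  the null set where the first one is 0 already makes the sum positive.\<close>

lemma AE_density_measure: "AE u in density_measure G. 0 < fst (fst u) + snd (fst u)"
proof -
  note G_measurable [measurable (raw)]
  have "AE q in lborel. fst (fst (q :: (real \<times> real) \<times> (real^'n) \<times> (real^'n))) \<noteq> 0"
  proof -
    have "AE t in lborel. fst (t :: real \<times> real) \<noteq> 0"
      using AE_lborel_singleton[of "0::real"] by (intro AE_lborel_pairI) auto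
    then show ?thesis
      by (intro AE_lborel_pairI[where Q = "\<lambda>q. fst (fst q) \<noteq> 0"]) auto
  qed
  then have "AE u in lborel. 0 < ennreal (G (fst (fst u)) (fst (snd u)) * G (snd (fst u)) (snd (snd u))) \<longrightarrow>
      0 < fst (fst u) + snd (fst u)"
  proof eventually_elim
    case (elim u)
    show ?case
    proof
      assume "0 < ennreal (G (fst (fst u)) (fst (snd u)) * G (snd (fst u)) (snd (snd u)))"
      then have "fst (fst u) \<in> {0..T}" "snd (fst u) \<in> {0..T}"
        using G_supp by (force, force)
      then show "0 < fst (fst u) + snd (fst u)"
        using elim by auto
    qed
  qed
  then show ?thesis
    unfolding density_measure_def by (subst AE_density) auto
qed

lemma integral_density_measure:
  fixes F :: "(real \<times> real) \<times> (real^'n) \<times> (real^'n) \<Rightarrow> complex"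
  assumes [measurable]: "F \<in> borel_measurable borel"
  shows "(\<integral>u. F (((\<eta>1, \<eta>2), (x1, x2)) - u) \<partial>density_measure G)
    = (\<integral>p. (case p of (\<eta>1', x1', \<eta>2', x2') \<Rightarrow>
        (G (\<eta>1 - \<eta>1') (x1 - x1') * G (\<eta>2 - \<eta>2') (x2 - x2')) *\<^sub>R F ((\<eta>1', \<eta>2'), (x1', x2'))) \<partial>lborel)"
proof -
  note G_measurable [measurable (raw)]
  let ?g = "\<lambda>u. G (fst (fst u)) (fst (snd u)) * G (snd (fst u)) (snd (snd u))"
  let ?p = "((\<eta>1, \<eta>2), (x1, x2))"
  have "(\<integral>u. F (?p - u) \<partial>density_measure G) = (\<integral>u. ?g u *\<^sub>R F (?p - u) \<partial>lborel)"
    unfolding density_measure_def by (intro integral_density) (auto simp: G_nonneg)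
  also have "\<dots> = (\<integral>q. ?g (?p - q) *\<^sub>R F q \<partial>lborel)"
    by (subst integral_lborel_reflect[where p = ?p]) simp_all
  also have "\<dots> = (\<integral>p. ?g (?p - regroup p) *\<^sub>R F (regroup p) \<partial>lborel)"
    by (subst distr_regroup[symmetric], subst integral_distr) simp_all
  also have "\<dots> = (\<integral>p. (case p of (\<eta>1', x1', \<eta>2', x2') \<Rightarrow>
        (G (\<eta>1 - \<eta>1') (x1 - x1') * G (\<eta>2 - \<eta>2') (x2 - x2')) *\<^sub>R F ((\<eta>1', \<eta>2'), (x1', x2'))) \<partial>lborel)"
    by (intro Bochner_Integration.integral_cong refl) (simp split: prod.split)
  finally show ?thesis .
qed

lemma integral_density_measure_interaction:
  fixes K \<psi> :: "'n field2"
  assumes d: "CARD('n) \<in> {1, 2, 3}" and a0: "a 0 = 0" and a_pos: "\<And>\<eta>. \<eta> > 0 \<Longrightarrow> a \<eta> > 0"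
    and [measurable]: "interaction T a K \<in> borel_measurable borel"
      "restr T (weighted CARD('n) a \<psi>) \<in> borel_measurable borel"
    and \<eta>: "\<eta>1 \<in> {0<..T}" "\<eta>2 \<in> {0<..T}"
  shows "(\<integral>u. interaction T a K (((\<eta>1, \<eta>2), (x1, x2)) - u)
        * restr T (weighted CARD('n) a \<psi>) (((\<eta>1, \<eta>2), (x1, x2)) - u) \<partial>density_measure G)
    = (\<integral>(\<eta>1', x1', \<eta>2', x2').
        (if \<eta>1' \<in> {0..\<eta>1} \<and> \<eta>2' \<in> {0..\<eta>2} then
          complex_of_real ((a \<eta>1')\<^sup>2 * (a \<eta>2')\<^sup>2 * G (\<eta>1 - \<eta>1') (x1 - x1') * G (\<eta>2 - \<eta>2') (x2 - x2'))
          * K \<eta>1' x1' \<eta>2' x2' * \<psi> \<eta>1' x1' \<eta>2' x2'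
         else 0) \<partial>lborel)"
proof (subst integral_density_measure)
  let ?F = "\<lambda>q. interaction T a K q * restr T (weighted CARD('n) a \<psi>) q"
  have "(G (\<eta>1 - \<eta>1') (x1 - x1') * G (\<eta>2 - \<eta>2') (x2 - x2')) *\<^sub>R ?F ((\<eta>1', \<eta>2'), (x1', x2'))
      = (if \<eta>1' \<in> {0..\<eta>1} \<and> \<eta>2' \<in> {0..\<eta>2} then
          complex_of_real ((a \<eta>1')\<^sup>2 * (a \<eta>2')\<^sup>2 * G (\<eta>1 - \<eta>1') (x1 - x1') * G (\<eta>2 - \<eta>2') (x2 - x2'))
          * K \<eta>1' x1' \<eta>2' x2' * \<psi> \<eta>1' x1' \<eta>2' x2'
         else 0)" for \<eta>1' x1' \<eta>2' x2'
  proof (cases "\<eta>1' \<in> {0..\<eta>1} \<and> \<eta>2' \<in> {0..\<eta>2}")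
    case True
    then have "\<eta>1' \<in> {0..T}" "\<eta>2' \<in> {0..T}"
      using \<eta> by auto
    note F = interaction_restr_weighted[where a = a, OF d a0 a_pos this]
    show ?thesis
      unfolding F using True by (simp add: scaleR_conv_of_real F)
  next
    case False
    \<comment> \<open>The causal range of integration is recovered from two sides:
      \<open>restr\<close> removes negative times, and the support of \<open>G\<close> removes times
      later than the observation times.\<close>
    then consider "\<eta>1' < 0 \<or> \<eta>2' < 0" | "\<eta>1 < \<eta>1'" | "\<eta>2 < \<eta>2'"
      by fastforce
    then show ?thesis
    proof cases
      case 1
      then show ?thesis
        using False by (auto simp: restr_def)
    next
      case 2
      then show ?thesis
        using False G_supp[of "\<eta>1 - \<eta>1'"] by auto
    next
      case 3
      then show ?thesis
        using False G_supp[of "\<eta>2 - \<eta>2'"] by auto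
    qed
  qed
  then show "(\<integral>p. (case p of (\<eta>1', x1', \<eta>2', x2') \<Rightarrow>
        (G (\<eta>1 - \<eta>1') (x1 - x1') * G (\<eta>2 - \<eta>2') (x2 - x2')) *\<^sub>R ?F ((\<eta>1', \<eta>2'), (x1', x2'))) \<partial>lborel)
    = (\<integral>(\<eta>1', x1', \<eta>2', x2').
        (if \<eta>1' \<in> {0..\<eta>1} \<and> \<eta>2' \<in> {0..\<eta>2} then
          complex_of_real ((a \<eta>1')\<^sup>2 * (a \<eta>2')\<^sup>2 * G (\<eta>1 - \<eta>1') (x1 - x1') * G (\<eta>2 - \<eta>2') (x2 - x2'))
          * K \<eta>1' x1' \<eta>2' x2' * \<psi> \<eta>1' x1' \<eta>2' x2'
         else 0) \<partial>lborel)"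
    by (simp only:)
qed measurable

end

section \<open>Dimension 3: Green functions concentrated on the light cone\<close>

definition green3 :: "real \<Rightarrow> 'a::real_normed_vector \<Rightarrow> real" where
  "green3 T y = (if norm y \<le> T then 1 / norm y else 0)"

text \<open>Up to a factor the Green function is the distribution delta(s - norm y) / norm y, which
  has no density. It becomes a measure as the image of a spatial density under the map that lifts
  each displacement to the cone.\<close>

definition cone_measure :: "real \<Rightarrow> ((real \<times> real) \<times> (real^'n::finite) \<times> (real^'n)) measure" where
  "cone_measure T = distr (density lborel (\<lambda>y. ennreal (green3 T (fst y) * green3 T (snd y)))) borel
     (\<lambda>y. ((norm (fst y), norm (snd y)), y))"

lemma green3_measurable [measurable]:
  "green3 T \<in> borel_measurable (borel :: 'a::euclidean_space measure)"
  unfolding green3_def[abs_def] by measurable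

lemma green3_nonneg: "0 \<le> green3 T y"
  by (simp add: green3_def)

lemma finite_cone_measure:
  assumes dim: "2 \<le> CARD('n::finite)" and T: "0 < T"
  shows "finite_measure (cone_measure T :: ((real \<times> real) \<times> (real^'n) \<times> (real^'n)) measure)"
proof -
  let ?I = "\<integral>\<^sup>+y. ennreal (green3 T (y :: real^'n)) \<partial>lborel"
  let ?M = "density lborel (\<lambda>y :: (real^'n) \<times> (real^'n). ennreal (green3 T (fst y) * green3 T (snd y)))"
  have "emeasure ?M (space ?M) = (\<integral>\<^sup>+y1. \<integral>\<^sup>+y2. ennreal (green3 T (y1 :: real^'n)) * ennreal (green3 T (y2 :: real^'n)) \<partial>lborel \<partial>lborel)"
  proof -
    have "emeasure ?M (space ?M) = (\<integral>\<^sup>+y. ennreal (green3 T (fst y) * green3 T (snd y)) \<partial>(lborel :: ((real^'n) \<times> (real^'n)) measure))"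
      by (simp add: emeasure_density)
    also have "\<dots> = (\<integral>\<^sup>+y1. \<integral>\<^sup>+y2. ennreal (green3 T (fst (y1, y2)) * green3 T (snd (y1 :: real^'n, y2 :: real^'n))) \<partial>lborel \<partial>lborel)"
      by (rule nn_integral_lborel_pair) measurable
    finally show ?thesis
      by (simp add: ennreal_mult green3_nonneg)
  qed
  also have "\<dots> = ?I * ?I"
    by (simp add: nn_integral_cmult nn_integral_multc)
  also have "\<dots> < \<infinity>"
    using nn_integral_inverse_norm_finite[of T, where 'a = "real^'n"] dim T
    by (simp add: ennreal_mult_less_top green3_def)
  finally have "finite_measure ?M"
    by (intro finite_measureI) simp
  then show ?thesis
    unfolding cone_measure_def by (rule finite_measure.finite_measure_distr) simp
qed

lemma AE_cone_measure: "AE u in cone_measure T. 0 < fst (fst u) + snd (fst u)"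
proof -
  have "0 < norm (fst y) + norm (snd y)" if "0 < ennreal (green3 T (fst y) * green3 T (snd y))" for y :: "(real^'a) \<times> (real^'a)"
  proof -
    \<comment> \<open>Since division by zero gives 0, \<open>green3\<close> vanishes at the apex of
      the cone.\<close>
    have "fst y \<noteq> 0"
      using that by (auto simp: green3_def split: if_splits)
    then show ?thesis
      by (simp add: add_pos_nonneg)
  qed
  then have "AE y in density lborel (\<lambda>y :: (real^'a) \<times> (real^'a). ennreal (green3 T (fst y) * green3 T (snd y))).
      0 < norm (fst y) + norm (snd y)"
    by (subst AE_density) auto
  then show ?thesis
    unfolding cone_measure_def by (subst AE_distr_iff) auto
qed

lemma integral_cone_measure:
  fixes F :: "(real \<times> real) \<times> (real^'n::finite) \<times> (real^'n) \<Rightarrow> complex"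
  assumes [measurable]: "F \<in> borel_measurable borel"
  shows "(\<integral>u. F (((\<eta>1, \<eta>2), (x1, x2)) - u) \<partial>cone_measure T)
    = (\<integral>(x1', x2'). (green3 T (x1 - x1') * green3 T (x2 - x2')) *\<^sub>R
          F ((\<eta>1 - norm (x1 - x1'), \<eta>2 - norm (x2 - x2')), (x1', x2')) \<partial>lborel)"
proof -
  let ?g = "\<lambda>y :: (real^'n) \<times> (real^'n). green3 T (fst y) * green3 T (snd y)"
  let ?f = "\<lambda>y. ?g y *\<^sub>R F ((\<eta>1 - norm (fst y), \<eta>2 - norm (snd y)), (x1, x2) - y)"
  have "(\<integral>u. F (((\<eta>1, \<eta>2), (x1, x2)) - u) \<partial>cone_measure T)
      = (\<integral>y. F (((\<eta>1, \<eta>2), (x1, x2)) - ((norm (fst y), norm (snd y)), y)) \<partial>density lborel ?g)"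
    unfolding cone_measure_def by (rule integral_distr) measurable
  also have "\<dots> = (\<integral>y. ?f y \<partial>lborel)"
    by (subst integral_density) (auto simp: green3_nonneg)
  also have "\<dots> = (\<integral>x'. ?f ((x1, x2) - x') \<partial>lborel)"
    by (rule integral_lborel_reflect) measurable
  also have "\<dots> = (\<integral>(x1', x2'). (green3 T (x1 - x1') * green3 T (x2 - x2')) *\<^sub>R
          F ((\<eta>1 - norm (x1 - x1'), \<eta>2 - norm (x2 - x2')), (x1', x2')) \<partial>lborel)"
    by (intro Bochner_Integration.integral_cong refl) (simp split: prod.split)
  finally show ?thesis .
qed

text \<open>Shaped after \<open>intop2\<close> and \<open>intop3\<close>, where the inverse weight
  stands between the constant and the integral, so that the outer weights cancel it by
  rewriting.\<close>

lemma mult_unit_cancel: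
  fixes p :: "'a::comm_monoid_mult"
  assumes "p * q = 1"
  shows "p * (z * q * y) = z * y"
proof -
  have "p * (z * q * y) = (p * q) * (z * y)"
    by (simp only: ac_simps)
  then show ?thesis
    by (simp add: assms)
qed

section \<open>The three integral equations as convolution equations\<close>

lemma intop1_eq_convolution:
  fixes K \<psi> :: "'n::finite field2"
  assumes d: "CARD('n) = 1" and a0: "a 0 = 0" and a_pos: "\<And>\<eta>. \<eta> > 0 \<Longrightarrow> a \<eta> > 0"
    and meas: "interaction T a K \<in> borel_measurable borel"
      "restr T (weighted CARD('n) a \<psi>) \<in> borel_measurable borel"
    and \<eta>: "\<eta>1 \<in> {0<..T}" "\<eta>2 \<in> {0<..T}"
  shows "complex_of_real (wgt CARD('n) a \<eta>1 * wgt CARD('n) a \<eta>2) * intop1 a K c \<psi> \<eta>1 x1 \<eta>2 x2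
        = (\<integral>u. c / 4 * interaction T a K (((\<eta>1, \<eta>2), (x1, x2)) - u)
             * restr T (weighted CARD('n) a \<psi>) (((\<eta>1, \<eta>2), (x1, x2)) - u) \<partial>density_measure (green1 T))"
proof -
  have "(\<integral>u. interaction T a K (((\<eta>1, \<eta>2), (x1, x2)) - u)
        * restr T (weighted CARD('n) a \<psi>) (((\<eta>1, \<eta>2), (x1, x2)) - u) \<partial>density_measure (green1 T))
    = (\<integral>(\<eta>1', x1', \<eta>2', x2').
        (if \<eta>1' \<in> {0..\<eta>1} \<and> \<eta>2' \<in> {0..\<eta>2} then
          complex_of_real ((a \<eta>1')\<^sup>2 * (a \<eta>2')\<^sup>2 * green1 T (\<eta>1 - \<eta>1') (x1 - x1') * green1 T (\<eta>2 - \<eta>2') (x2 - x2'))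
          * K \<eta>1' x1' \<eta>2' x2' * \<psi> \<eta>1' x1' \<eta>2' x2'
         else 0) \<partial>lborel)"
    using d by (intro integral_density_measure_interaction nn_integral_green1_finite a0 a_pos meas \<eta>)
      (auto simp: green1_def)
  also have "\<dots> = (\<integral>(\<eta>1', x1', \<eta>2', x2').
        (if \<eta>1' \<in> {0..\<eta>1} \<and> \<eta>2' \<in> {0..\<eta>2} then
          complex_of_real ((a \<eta>1')\<^sup>2 * (a \<eta>2')\<^sup>2
             * Heav (\<eta>1 - \<eta>1' - norm (x1 - x1')) * Heav (\<eta>2 - \<eta>2' - norm (x2 - x2')))
          * K \<eta>1' x1' \<eta>2' x2' * \<psi> \<eta>1' x1' \<eta>2' x2'
         else 0) \<partial>lborel)"
    using \<eta> by (intro Bochner_Integration.integral_cong refl) (auto simp: green1_def Heav_def)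
  finally show ?thesis
    using d by (simp add: intop1_def wgt_def mult.assoc)
qed

lemma intop2_eq_convolution:
  fixes K \<psi> :: "'n::finite field2"
  assumes d: "CARD('n) = 2" and a0: "a 0 = 0" and a_pos: "\<And>\<eta>. \<eta> > 0 \<Longrightarrow> a \<eta> > 0"
    and meas: "interaction T a K \<in> borel_measurable borel"
      "restr T (weighted CARD('n) a \<psi>) \<in> borel_measurable borel"
    and \<eta>: "\<eta>1 \<in> {0<..T}" "\<eta>2 \<in> {0<..T}"
  shows "complex_of_real (wgt CARD('n) a \<eta>1 * wgt CARD('n) a \<eta>2) * intop2 a K c \<psi> \<eta>1 x1 \<eta>2 x2
        = (\<integral>u. c / (2 * pi)\<^sup>2 * interaction T a K (((\<eta>1, \<eta>2), (x1, x2)) - u)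
             * restr T (weighted CARD('n) a \<psi>) (((\<eta>1, \<eta>2), (x1, x2)) - u) \<partial>density_measure (green2 T))"
proof -
  have T: "0 < T"
    using \<eta> by auto
  have "(\<integral>u. interaction T a K (((\<eta>1, \<eta>2), (x1, x2)) - u)
        * restr T (weighted CARD('n) a \<psi>) (((\<eta>1, \<eta>2), (x1, x2)) - u) \<partial>density_measure (green2 T))
    = (\<integral>(\<eta>1', x1', \<eta>2', x2').
        (if \<eta>1' \<in> {0..\<eta>1} \<and> \<eta>2' \<in> {0..\<eta>2} then
          complex_of_real ((a \<eta>1')\<^sup>2 * (a \<eta>2')\<^sup>2 * green2 T (\<eta>1 - \<eta>1') (x1 - x1') * green2 T (\<eta>2 - \<eta>2') (x2 - x2'))
          * K \<eta>1' x1' \<eta>2' x2' * \<psi> \<eta>1' x1' \<eta>2' x2'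
         else 0) \<partial>lborel)"
    using d T by (intro integral_density_measure_interaction nn_integral_green2_finite a0 a_pos meas \<eta>)
      (auto simp: green2_def)
  also have "\<dots> = (\<integral>(\<eta>1', x1', \<eta>2', x2').
        (if \<eta>1' \<in> {0..\<eta>1} \<and> \<eta>2' \<in> {0..\<eta>2} then
          complex_of_real ((a \<eta>1')\<^sup>2 * (a \<eta>2')\<^sup>2
             * (Heav (\<eta>1 - \<eta>1' - norm (x1 - x1')) / sqrt ((\<eta>1 - \<eta>1')\<^sup>2 - (norm (x1 - x1'))\<^sup>2))
             * (Heav (\<eta>2 - \<eta>2' - norm (x2 - x2')) / sqrt ((\<eta>2 - \<eta>2')\<^sup>2 - (norm (x2 - x2'))\<^sup>2)))
          * K \<eta>1' x1' \<eta>2' x2' * \<psi> \<eta>1' x1' \<eta>2' x2'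
         else 0) \<partial>lborel)"
    using \<eta> by (intro Bochner_Integration.integral_cong refl) (auto simp: green2_def Heav_def)
  finally have eq: "(\<integral>u. interaction T a K (((\<eta>1, \<eta>2), (x1, x2)) - u)
        * restr T (weighted CARD('n) a \<psi>) (((\<eta>1, \<eta>2), (x1, x2)) - u) \<partial>density_measure (green2 T)) = \<dots>" .
  have "wgt CARD('n) a \<eta>1 * wgt CARD('n) a \<eta>2 * (1 / sqrt (a \<eta>1 * a \<eta>2)) = 1"
    using d \<eta> a_pos[of \<eta>1] a_pos[of \<eta>2] by (simp add: wgt_def real_sqrt_mult)
  then have w1: "complex_of_real (wgt CARD('n) a \<eta>1 * wgt CARD('n) a \<eta>2) * complex_of_real (1 / sqrt (a \<eta>1 * a \<eta>2)) = 1"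
    by (simp only: of_real_mult[symmetric] of_real_1)
  have w: "complex_of_real (wgt CARD('n) a \<eta>1 * wgt CARD('n) a \<eta>2) * (z * complex_of_real (1 / sqrt (a \<eta>1 * a \<eta>2)) * y) = z * y" for z y
    using w1 by (rule mult_unit_cancel)
  show ?thesis
    unfolding intop2_def w eq[symmetric] by (simp add: mult.assoc)
qed

lemma intop3_eq_convolution:
  fixes K \<psi> :: "'n::finite field2"
  assumes d: "CARD('n) = 3" and a0: "a 0 = 0" and a_pos: "\<And>\<eta>. \<eta> > 0 \<Longrightarrow> a \<eta> > 0"
    and meas [measurable]: "interaction T a K \<in> borel_measurable borel"
      "restr T (weighted CARD('n) a \<psi>) \<in> borel_measurable borel"
    and \<eta>: "\<eta>1 \<in> {0<..T}" "\<eta>2 \<in> {0<..T}"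
  shows "complex_of_real (wgt CARD('n) a \<eta>1 * wgt CARD('n) a \<eta>2) * intop3 a K c \<psi> \<eta>1 x1 \<eta>2 x2
        = (\<integral>u. c / (4 * pi)\<^sup>2 * interaction T a K (((\<eta>1, \<eta>2), (x1, x2)) - u)
             * restr T (weighted CARD('n) a \<psi>) (((\<eta>1, \<eta>2), (x1, x2)) - u) \<partial>cone_measure T)"
proof -
  have d': "CARD('n) \<in> {1, 2, 3}"
    using d by simp
  let ?F = "\<lambda>q. interaction T a K q * restr T (weighted CARD('n) a \<psi>) q"
  have pointwise: "(green3 T (x1 - x1') * green3 T (x2 - x2')) *\<^sub>R
          ?F ((\<eta>1 - norm (x1 - x1'), \<eta>2 - norm (x2 - x2')), (x1', x2'))
      = (if Heav (\<eta>1 - norm (x1 - x1')) = 0 \<or> Heav (\<eta>2 - norm (x2 - x2')) = 0 then 0 else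
          complex_of_real ((a (\<eta>1 - norm (x1 - x1')))\<^sup>2 * (a (\<eta>2 - norm (x2 - x2')))\<^sup>2
             * (Heav (\<eta>1 - norm (x1 - x1')) / norm (x1 - x1'))
             * (Heav (\<eta>2 - norm (x2 - x2')) / norm (x2 - x2')))
          * K (\<eta>1 - norm (x1 - x1')) x1' (\<eta>2 - norm (x2 - x2')) x2'
          * \<psi> (\<eta>1 - norm (x1 - x1')) x1' (\<eta>2 - norm (x2 - x2')) x2')" for x1' x2'
  proof (cases "norm (x1 - x1') \<le> \<eta>1 \<and> norm (x2 - x2') \<le> \<eta>2")
    case True
    then have t: "\<eta>1 - norm (x1 - x1') \<in> {0..T}" "\<eta>2 - norm (x2 - x2') \<in> {0..T}"
        "norm (x1 - x1') \<le> T" "norm (x2 - x2') \<le> T"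
      using \<eta> by (auto intro: order_trans[OF diff_le_self] simp: diff_le_eq add_increasing2)
    note F = interaction_restr_weighted[where a = a, OF d' a0 a_pos t(1,2)]
    show ?thesis
      using True t(3,4) by (simp add: F green3_def Heav_def scaleR_conv_of_real)
  next
    \<comment> \<open>One retarded time is negative here, and \<open>restr\<close> takes over the
      task of the Heaviside factor.\<close>
    case False
    then show ?thesis
      by (auto simp: Heav_def restr_def)
  qed
  have eq: "(\<integral>u. ?F (((\<eta>1, \<eta>2), (x1, x2)) - u) \<partial>cone_measure T)
      = (\<integral>(x1', x2').
        (if Heav (\<eta>1 - norm (x1 - x1')) = 0 \<or> Heav (\<eta>2 - norm (x2 - x2')) = 0 then 0 else
          complex_of_real ((a (\<eta>1 - norm (x1 - x1')))\<^sup>2 * (a (\<eta>2 - norm (x2 - x2')))\<^sup>2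
             * (Heav (\<eta>1 - norm (x1 - x1')) / norm (x1 - x1'))
             * (Heav (\<eta>2 - norm (x2 - x2')) / norm (x2 - x2')))
          * K (\<eta>1 - norm (x1 - x1')) x1' (\<eta>2 - norm (x2 - x2')) x2'
          * \<psi> (\<eta>1 - norm (x1 - x1')) x1' (\<eta>2 - norm (x2 - x2')) x2') \<partial>lborel)"
    unfolding pointwise[symmetric] by (rule integral_cone_measure) measurable
  have "wgt CARD('n) a \<eta>1 * wgt CARD('n) a \<eta>2 * (1 / (a \<eta>1 * a \<eta>2)) = 1"
    using d \<eta> a_pos[of \<eta>1] a_pos[of \<eta>2] by (simp add: wgt_def)
  then have w1: "complex_of_real (wgt CARD('n) a \<eta>1 * wgt CARD('n) a \<eta>2) * complex_of_real (1 / (a \<eta>1 * a \<eta>2)) = 1"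
    by (simp only: of_real_mult[symmetric] of_real_1)
  have w: "complex_of_real (wgt CARD('n) a \<eta>1 * wgt CARD('n) a \<eta>2) * (z * complex_of_real (1 / (a \<eta>1 * a \<eta>2)) * y) = z * y" for z y
    using w1 by (rule mult_unit_cancel)
  show ?thesis
    unfolding intop3_def w eq[symmetric] by (simp add: mult.assoc)
qed

theorem theorem4p1:
  fixes T :: real and a :: "real \<Rightarrow> real" and K :: "'n::finite field2"
    and c :: complex and \<psi>free :: "'n field2"
  assumes T: "T > 0"
    and d: "CARD('n) \<in> {1, 2, 3}"
    and a_cont: "continuous_on {0..} a"
    and a0: "a 0 = 0"
    and a_pos: "\<And>\<eta>. \<eta> > 0 \<Longrightarrow> a \<eta> > 0"
    and K_bdd: "\<exists>M. \<forall>\<eta>1 \<ge> 0. \<forall>\<eta>2 \<ge> 0. \<forall>x1 x2. cmod (K \<eta>1 x1 \<eta>2 x2) \<le> M"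
    and K_meas: "(\<lambda>(\<eta>1, x1, \<eta>2, x2). if \<eta>1 \<ge> 0 \<and> \<eta>2 \<ge> 0 then K \<eta>1 x1 \<eta>2 x2 else 0)
                   \<in> borel_measurable lborel"
    and free: "inB T (weighted CARD('n) a \<psi>free)"
  shows "\<exists>\<psi>. inB T (weighted CARD('n) a \<psi>) \<and> solves T a K c \<psi>free \<psi> \<and>
           (\<forall>\<phi>. inB T (weighted CARD('n) a \<phi>) \<and> solves T a K c \<psi>free \<phi> \<longrightarrow>
              (AE p in lborel. case p of (\<eta>1, x1, \<eta>2, x2) \<Rightarrow>
                 \<eta>1 \<in> {0..T} \<and> \<eta>2 \<in> {0..T} \<longrightarrow> \<phi> \<eta>1 x1 \<eta>2 x2 = \<psi> \<eta>1 x1 \<eta>2 x2))"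
proof -
  note interaction = interaction_measurable[OF a_cont K_meas, of T]
  note well_posed = well_posed_of_convolution[OF a_cont a_pos K_bdd K_meas free]
  consider "CARD('n) = 1" | "CARD('n) = 2" | "CARD('n) = 3"
    using d by auto
  then show ?thesis
  proof cases
    case 1
    show ?thesis
    proof (rule well_posed[where \<nu> = "density_measure (green1 T)" and \<gamma> = "c / 4"])
      show "finite_measure (density_measure (green1 T :: real \<Rightarrow> real^'n \<Rightarrow> real))"
        by (rule finite_density_measure[OF _ _ _ nn_integral_green1_finite]) (auto simp: green1_def)
      show "AE u in density_measure (green1 T :: real \<Rightarrow> real^'n \<Rightarrow> real). 0 < fst (fst u) + snd (fst u)"
        by (rule AE_density_measure[OF _ _ _ nn_integral_green1_finite]) (auto simp: green1_def)
      show "complex_of_real (wgt CARD('n) a \<eta>1 * wgt CARD('n) a \<eta>2) * intop a K c \<psi> \<eta>1 x1 \<eta>2 x2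
        = (\<integral>u. c / 4 * interaction T a K (((\<eta>1, \<eta>2), (x1, x2)) - u)
             * restr T (weighted CARD('n) a \<psi>) (((\<eta>1, \<eta>2), (x1, x2)) - u) \<partial>density_measure (green1 T))"
        if "restr T (weighted CARD('n) a \<psi>) \<in> borel_measurable borel" "\<eta>1 \<in> {0<..T}" "\<eta>2 \<in> {0<..T}"
        for \<psi> \<eta>1 x1 \<eta>2 x2
        using intop1_eq_convolution[where a = a, OF 1 a0 a_pos interaction that] 1 by (simp add: intop_def)
    qed (simp_all add: density_measure_def)
  next
    case 2
    note fin = nn_integral_green2_finite[of T, where 'a = "real^'n"]
    show ?thesis
    proof (rule well_posed[where \<nu> = "density_measure (green2 T)" and \<gamma> = "c / (2 * pi)\<^sup>2"])
      show "finite_measure (density_measure (green2 T :: real \<Rightarrow> real^'n \<Rightarrow> real))"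
        using 2 T by (intro finite_density_measure[OF _ _ _ fin]) (auto simp: green2_def)
      show "AE u in density_measure (green2 T :: real \<Rightarrow> real^'n \<Rightarrow> real). 0 < fst (fst u) + snd (fst u)"
        using 2 T by (intro AE_density_measure[OF _ _ _ fin]) (auto simp: green2_def)
      show "complex_of_real (wgt CARD('n) a \<eta>1 * wgt CARD('n) a \<eta>2) * intop a K c \<psi> \<eta>1 x1 \<eta>2 x2
        = (\<integral>u. c / (2 * pi)\<^sup>2 * interaction T a K (((\<eta>1, \<eta>2), (x1, x2)) - u)
             * restr T (weighted CARD('n) a \<psi>) (((\<eta>1, \<eta>2), (x1, x2)) - u) \<partial>density_measure (green2 T))"
        if "restr T (weighted CARD('n) a \<psi>) \<in> borel_measurable borel" "\<eta>1 \<in> {0<..T}" "\<eta>2 \<in> {0<..T}"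
        for \<psi> \<eta>1 x1 \<eta>2 x2
        using intop2_eq_convolution[where a = a, OF 2 a0 a_pos interaction that] 2 by (simp add: intop_def)
    qed (simp_all add: density_measure_def)
  next
    case 3
    show ?thesis
    proof (rule well_posed[where \<nu> = "cone_measure T" and \<gamma> = "c / (4 * pi)\<^sup>2"])
      show "finite_measure (cone_measure T :: ((real \<times> real) \<times> (real^'n) \<times> (real^'n)) measure)"
        using 3 T by (intro finite_cone_measure) auto
      show "AE u in (cone_measure T :: ((real \<times> real) \<times> (real^'n) \<times> (real^'n)) measure). 0 < fst (fst u) + snd (fst u)"
        by (rule AE_cone_measure)
      show "complex_of_real (wgt CARD('n) a \<eta>1 * wgt CARD('n) a \<eta>2) * intop a K c \<psi> \<eta>1 x1 \<eta>2 x2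
        = (\<integral>u. c / (4 * pi)\<^sup>2 * interaction T a K (((\<eta>1, \<eta>2), (x1, x2)) - u)
             * restr T (weighted CARD('n) a \<psi>) (((\<eta>1, \<eta>2), (x1, x2)) - u) \<partial>cone_measure T)"
        if "restr T (weighted CARD('n) a \<psi>) \<in> borel_measurable borel" "\<eta>1 \<in> {0<..T}" "\<eta>2 \<in> {0<..T}"
        for \<psi> \<eta>1 x1 \<eta>2 x2
        using intop3_eq_convolution[where a = a, OF 3 a0 a_pos interaction that] 3 by (simp add: intop_def)
    qed (simp_all add: cone_measure_def)
  qed
qed

end
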